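(* Let $G$ be a finite group and let $G=H_1\ge H_2\ge\cdots\ge H_N=1$ be an $N$-series of $G$ (with $H_m=1$ for $m\ge N$), where the multiplication table of $G$ and the subgroups $H_i$ are given explicitly. Then $$A_\bullet\text{ realizes }H_\bullet\iff \operatorname{coker}R_n^{\rm bar}=0\quad\text{for all }1\le n<N .$$ Moreover, the conditions on the right are effectively decidable by integer linear algebra: there is an algorithm, consisting of finitely many computations with integer matrices and lattices, which from the multiplication table of $G$ and the subgroups $H_i$ decides whether $\operatorname{coker}R_n^{\rm bar}=0$ for each $1\le n<N$.
   Context: An $N$-series of a group $G$ is a descending chain of subgroups $G=H_1\ge H_2\ge\cdots$ with $[H_a,H_b]\le H_{a+b}$. For $m\ge1$, $A_m\subseteq\mathbf Z[G]$ is the additive subgroup generated by all products $(x_1-1)\cdots(x_r-1)$ with $x_\nu\in H_{a_\nu}$ and $\sum_\nu a_\nu\ge m$ (it is a two-sided ideal). The homomorphism $\phi_n:H_n/H_{n+1}\to A_n/A_{n+1}$ is $hH_{n+1}\mapsto (h-1)+A_{n+1}$. One says that $A_\bullet$ realizes $H_\bullet$ when $\phi_n$ is injective for every $n\ge1$. Put $E_n=G/H_{n+1}$, $Q_n=G/H_n$, $C_n=H_n/H_{n+1}$, and let $\pi_n:E_n\to Q_n$ be the projection, a central extension with kernel $C_n$. For a group $Q$, $\overline C_r(Q)$ is the free abelian group on symbols $[q_1|\cdots|q_r]$ with all $q_i\ne1$ (symbols containing an identity are interpreted as $0$), with the normalized bar boundary with trivial integral coefficients $$\partial[q_1|\cdots|q_r]=[q_2|\cdots|q_r]+\sum_{i=1}^{r-1}(-1)^i[q_1|\cdots|q_iq_{i+1}|\cdots|q_r]+(-1)^r[q_1|\cdots|q_{r-1}].$$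 $Z_2(Q)=\ker(\partial:\overline C_2(Q)\to\overline C_1(Q))$. The chain map induced by $\pi_n$ is $(\pi_n)_\#$. Choose a normalized set-theoretic section $s_n:Q_n\to E_n$ and let $\alpha_n(q,q')=s_n(q)s_n(q')s_n(qq')^{-1}\in C_n$. Let $\vartheta_{n,s}:\overline C_2(Q_n)\to A_n/A_{n+1}$ be the homomorphism $[q|q']\mapsto(\widetilde\alpha_n(q,q')-1)+A_{n+1}$, where $\widetilde\alpha_n(q,q')\in H_n$ represents $\alpha_n(q,q')$. Put $D_n^{\rm bar}=\ker(\vartheta_{n,s}|_{Z_2(Q_n)})\subseteq Z_2(Q_n)$ (independent of the choice of $s_n$). Define $$L_n^{\rm bar}=\{(z_E,c_Q)\in Z_2(E_n)\oplus\overline C_3(Q_n):(\pi_n)_\#z_E+\partial c_Q\in D_n^{\rm bar}\}$$ and $R_n^{\rm bar}:L_n^{\rm bar}\to D_n^{\rm bar}$, $R_n^{\rm bar}(z_E,c_Q)=(\pi_n)_\#z_E+\partial c_Q$. *)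

theory Defs
  imports "HOL-Algebra.Free_Abelian_Groups" "Jordan_Normal_Form.Matrix"
begin

definition commutator_subgroup :: "('a, 'b) monoid_scheme \<Rightarrow> 'a set \<Rightarrow> 'a set \<Rightarrow> 'a set" where
  "commutator_subgroup G A B =
     generate G {a \<otimes>\<^bsub>G\<^esub> b \<otimes>\<^bsub>G\<^esub> inv\<^bsub>G\<^esub> a \<otimes>\<^bsub>G\<^esub> inv\<^bsub>G\<^esub> b | a b. a \<in> A \<and> b \<in> B}"

text \<open>The series is indexed from 1; the value \<open>H 0\<close> is never used.\<close>

definition N_series :: "('a, 'b) monoid_scheme \<Rightarrow> (nat \<Rightarrow> 'a set) \<Rightarrow> bool" where
  "N_series G H \<longleftrightarrow>
     H 1 = carrier G \<and>
     (\<forall>a\<ge>1. subgroup (H a) G \<and> H (Suc a) \<subseteq> H a) \<and>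
     (\<forall>a\<ge>1. \<forall>b\<ge>1. commutator_subgroup G (H a) (H b) \<subseteq> H (a + b))"

definition finite_N_series :: "('a, 'b) monoid_scheme \<Rightarrow> (nat \<Rightarrow> 'a set) \<Rightarrow> nat \<Rightarrow> bool" where
  "finite_N_series G H N \<longleftrightarrow>
     group G \<and> finite (carrier G) \<and> N_series G H \<and> 1 \<le> N \<and> (\<forall>m\<ge>N. H m = {\<one>\<^bsub>G\<^esub>})"

definition group_ring :: "('a, 'b) monoid_scheme \<Rightarrow> ('a \<Rightarrow>\<^sub>0 int) ring" where
  "group_ring G =
     \<lparr>carrier = carrier (free_Abelian_group (carrier G)),
      monoid.mult = (\<lambda>u v. frag_extend (\<lambda>g. frag_extend (\<lambda>h. frag_of (g \<otimes>\<^bsub>G\<^esub> h)) v) u),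
      one = frag_of \<one>\<^bsub>G\<^esub>,
      zero = 0,
      add = (+)\<rparr>"

definition aug :: "('a, 'b) monoid_scheme \<Rightarrow> 'a \<Rightarrow> ('a \<Rightarrow>\<^sub>0 int)" where
  "aug G x = frag_of x - frag_of \<one>\<^bsub>G\<^esub>"

text \<open>A list \<open>[(x\<^sub>1, a\<^sub>1), \<dots>, (x\<^sub>r, a\<^sub>r)]\<close> stands for the product of the \<open>x\<^sub>\<nu> - 1\<close>
  with \<open>x\<^sub>\<nu> \<in> H a\<^sub>\<nu>\<close>.\<close>

definition filt :: "('a, 'b) monoid_scheme \<Rightarrow> (nat \<Rightarrow> 'a set) \<Rightarrow> nat \<Rightarrow> ('a \<Rightarrow>\<^sub>0 int) set" where
  "filt G H m =
     generate (add_monoid (group_ring G))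
       {foldr (\<lambda>(x, a) p. aug G x \<otimes>\<^bsub>group_ring G\<^esub> p) ps \<one>\<^bsub>group_ring G\<^esub> | ps.
          (\<forall>(x, a) \<in> set ps. 1 \<le> a \<and> x \<in> H a) \<and> m \<le> sum_list (map snd ps)}"

definition filt_quot ::
  "('a, 'b) monoid_scheme \<Rightarrow> (nat \<Rightarrow> 'a set) \<Rightarrow> nat \<Rightarrow> ('a \<Rightarrow>\<^sub>0 int) set monoid" where
  "filt_quot G H n = (add_monoid (group_ring G))\<lparr>carrier := filt G H n\<rparr> Mod filt G H (Suc n)"

definition filt_class ::
  "('a, 'b) monoid_scheme \<Rightarrow> (nat \<Rightarrow> 'a set) \<Rightarrow> nat \<Rightarrow> ('a \<Rightarrow>\<^sub>0 int) \<Rightarrow> ('a \<Rightarrow>\<^sub>0 int) set" where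
  "filt_class G H n u = filt G H (Suc n) #>\<^bsub>add_monoid (group_ring G)\<^esub> u"

definition C_grp :: "('a, 'b) monoid_scheme \<Rightarrow> (nat \<Rightarrow> 'a set) \<Rightarrow> nat \<Rightarrow> 'a set monoid" where
  "C_grp G H n = G\<lparr>carrier := H n\<rparr> Mod H (Suc n)"

text \<open>As for homomorphisms induced on \<open>Mod\<close> in the library, \<open>the_elem\<close> extracts the common
  value on all representatives of the coset \<open>X\<close>.\<close>

definition phi ::
  "('a, 'b) monoid_scheme \<Rightarrow> (nat \<Rightarrow> 'a set) \<Rightarrow> nat \<Rightarrow> 'a set \<Rightarrow> ('a \<Rightarrow>\<^sub>0 int) set" where
  "phi G H n X = the_elem ((\<lambda>h. filt_class G H n (aug G h)) ` X)"

definition realizes :: "('a, 'b) monoid_scheme \<Rightarrow> (nat \<Rightarrow> 'a set) \<Rightarrow> bool" where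
  "realizes G H \<longleftrightarrow> (\<forall>n\<ge>1. inj_on (phi G H n) (carrier (C_grp G H n)))"

text \<open>The symbol \<open>[q\<^sub>1|\<dots>|q\<^sub>r]\<close> is the list \<open>[q\<^sub>1, \<dots>, q\<^sub>r]\<close>.\<close>

definition bar_basis :: "('q, 'b) monoid_scheme \<Rightarrow> nat \<Rightarrow> 'q list set" where
  "bar_basis Q r = {qs. length qs = r \<and> set qs \<subseteq> carrier Q - {\<one>\<^bsub>Q\<^esub>}}"

definition bar_chains :: "('q, 'b) monoid_scheme \<Rightarrow> nat \<Rightarrow> ('q list \<Rightarrow>\<^sub>0 int) monoid" where
  "bar_chains Q r = free_Abelian_group (bar_basis Q r)"

definition bar_sym :: "('q, 'b) monoid_scheme \<Rightarrow> 'q list \<Rightarrow> ('q list \<Rightarrow>\<^sub>0 int)" where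
  "bar_sym Q qs = (if \<one>\<^bsub>Q\<^esub> \<in> set qs then 0 else frag_of qs)"

text \<open>\<open>bar_merge Q i [q\<^sub>1, \<dots>, q\<^sub>r] = [q\<^sub>1, \<dots>, q\<^sub>i q\<^sub>i\<^sub>+\<^sub>1, \<dots>, q\<^sub>r]\<close> for \<open>1 \<le> i < r\<close>; list positions are
  counted from 0, hence the shift.\<close>

definition bar_merge :: "('q, 'b) monoid_scheme \<Rightarrow> nat \<Rightarrow> 'q list \<Rightarrow> 'q list" where
  "bar_merge Q i qs = take (i - 1) qs @ [qs ! (i - 1) \<otimes>\<^bsub>Q\<^esub> qs ! i] @ drop (i + 1) qs"

text \<open>The boundary is meant, and only used, on chains of degree at least 1.\<close>

definition bar_bd :: "('q, 'b) monoid_scheme \<Rightarrow> ('q list \<Rightarrow>\<^sub>0 int) \<Rightarrow> ('q list \<Rightarrow>\<^sub>0 int)" where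
  "bar_bd Q = frag_extend (\<lambda>qs.
       bar_sym Q (tl qs)
     + (\<Sum>i = 1..<length qs. frag_cmul ((-1) ^ i) (bar_sym Q (bar_merge Q i qs)))
     + frag_cmul ((-1) ^ length qs) (bar_sym Q (butlast qs)))"

definition Z2 :: "('q, 'b) monoid_scheme \<Rightarrow> ('q list \<Rightarrow>\<^sub>0 int) set" where
  "Z2 Q = kernel (bar_chains Q 2) (bar_chains Q 1) (bar_bd Q)"

definition bar_map :: "('q, 'b) monoid_scheme \<Rightarrow> ('e \<Rightarrow> 'q) \<Rightarrow> ('e list \<Rightarrow>\<^sub>0 int) \<Rightarrow> ('q list \<Rightarrow>\<^sub>0 int)" where
  "bar_map Q f = frag_extend (\<lambda>es. bar_sym Q (map f es))"

definition E_grp :: "('a, 'b) monoid_scheme \<Rightarrow> (nat \<Rightarrow> 'a set) \<Rightarrow> nat \<Rightarrow> 'a set monoid" where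
  "E_grp G H n = G Mod H (Suc n)"

definition Q_grp :: "('a, 'b) monoid_scheme \<Rightarrow> (nat \<Rightarrow> 'a set) \<Rightarrow> nat \<Rightarrow> 'a set monoid" where
  "Q_grp G H n = G Mod H n"

text \<open>\<open>H n <#> H (n + 1) g = H n g\<close>\<close>

definition proj :: "('a, 'b) monoid_scheme \<Rightarrow> (nat \<Rightarrow> 'a set) \<Rightarrow> nat \<Rightarrow> 'a set \<Rightarrow> 'a set" where
  "proj G H n X = H n <#>\<^bsub>G\<^esub> X"

definition normalized_section ::
  "('a, 'b) monoid_scheme \<Rightarrow> (nat \<Rightarrow> 'a set) \<Rightarrow> nat \<Rightarrow> ('a set \<Rightarrow> 'a set) \<Rightarrow> bool" where
  "normalized_section G H n s \<longleftrightarrow>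
     (\<forall>q \<in> carrier (Q_grp G H n). s q \<in> carrier (E_grp G H n) \<and> proj G H n (s q) = q) \<and>
     s \<one>\<^bsub>Q_grp G H n\<^esub> = \<one>\<^bsub>E_grp G H n\<^esub>"

definition alpha ::
  "('a, 'b) monoid_scheme \<Rightarrow> (nat \<Rightarrow> 'a set) \<Rightarrow> nat \<Rightarrow> ('a set \<Rightarrow> 'a set) \<Rightarrow> 'a set \<Rightarrow> 'a set \<Rightarrow> 'a set" where
  "alpha G H n s q q' =
     s q \<otimes>\<^bsub>E_grp G H n\<^esub> s q' \<otimes>\<^bsub>E_grp G H n\<^esub> inv\<^bsub>E_grp G H n\<^esub> (s (q \<otimes>\<^bsub>Q_grp G H n\<^esub> q'))"

text \<open>The value of \<open>alpha\<close> is a coset of \<open>H (n + 1)\<close> contained in \<open>H n\<close>, and its representatives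
  are its elements. The chain is lifted linearly to \<open>filt G H n\<close> and then reduced modulo
  \<open>filt G H (n + 1)\<close>, so that the choice of representatives is immaterial.\<close>

definition alpha_rep ::
  "('a, 'b) monoid_scheme \<Rightarrow> (nat \<Rightarrow> 'a set) \<Rightarrow> nat \<Rightarrow> ('a set \<Rightarrow> 'a set) \<Rightarrow> 'a set \<Rightarrow> 'a set \<Rightarrow> 'a" where
  "alpha_rep G H n s q q' = (SOME h. h \<in> alpha G H n s q q')"

definition vartheta ::
  "('a, 'b) monoid_scheme \<Rightarrow> (nat \<Rightarrow> 'a set) \<Rightarrow> nat \<Rightarrow> ('a set \<Rightarrow> 'a set)
     \<Rightarrow> ('a set list \<Rightarrow>\<^sub>0 int) \<Rightarrow> ('a \<Rightarrow>\<^sub>0 int) set" where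
  "vartheta G H n s c =
     filt_class G H n (frag_extend (\<lambda>qs. aug G (alpha_rep G H n s (qs ! 0) (qs ! 1))) c)"

definition D_bar ::
  "('a, 'b) monoid_scheme \<Rightarrow> (nat \<Rightarrow> 'a set) \<Rightarrow> nat \<Rightarrow> ('a set \<Rightarrow> 'a set) \<Rightarrow> ('a set list \<Rightarrow>\<^sub>0 int) monoid" where
  "D_bar G H n s =
     (bar_chains (Q_grp G H n) 2)
       \<lparr>carrier := kernel ((bar_chains (Q_grp G H n) 2)\<lparr>carrier := Z2 (Q_grp G H n)\<rparr>)
                    (filt_quot G H n) (vartheta G H n s)\<rparr>"

definition R_bar ::
  "('a, 'b) monoid_scheme \<Rightarrow> (nat \<Rightarrow> 'a set) \<Rightarrow> nat
     \<Rightarrow> ('a set list \<Rightarrow>\<^sub>0 int) \<times> ('a set list \<Rightarrow>\<^sub>0 int) \<Rightarrow> ('a set list \<Rightarrow>\<^sub>0 int)" where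
  "R_bar G H n = (\<lambda>(z, c). bar_map (Q_grp G H n) (proj G H n) z + bar_bd (Q_grp G H n) c)"

definition L_bar ::
  "('a, 'b) monoid_scheme \<Rightarrow> (nat \<Rightarrow> 'a set) \<Rightarrow> nat \<Rightarrow> ('a set \<Rightarrow> 'a set)
     \<Rightarrow> (('a set list \<Rightarrow>\<^sub>0 int) \<times> ('a set list \<Rightarrow>\<^sub>0 int)) monoid" where
  "L_bar G H n s =
     (bar_chains (E_grp G H n) 2 \<times>\<times> bar_chains (Q_grp G H n) 3)
       \<lparr>carrier := {(z, c) \<in> Z2 (E_grp G H n) \<times> carrier (bar_chains (Q_grp G H n) 3).
                      R_bar G H n (z, c) \<in> carrier (D_bar G H n s)}\<rparr>"

definition coker ::
  "('c, 'x) monoid_scheme \<Rightarrow> ('d, 'y) monoid_scheme \<Rightarrow> ('c \<Rightarrow> 'd) \<Rightarrow> 'd set monoid" where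
  "coker A B f = B Mod (f ` carrier A)"

definition coker_R_bar ::
  "('a, 'b) monoid_scheme \<Rightarrow> (nat \<Rightarrow> 'a set) \<Rightarrow> nat \<Rightarrow> ('a set \<Rightarrow> 'a set)
     \<Rightarrow> ('a set list \<Rightarrow>\<^sub>0 int) set monoid" where
  "coker_R_bar G H n s = coker (L_bar G H n s) (D_bar G H n s) (R_bar G H n)"

text \<open>Programs act on registers holding integers and registers holding integer matrices of arbitrary
  size; a lattice is handled through a matrix of generators. All primitive steps are elementary
  arithmetic on integers and on matrix entries, so a terminating run is a finite computation with
  integer matrices and no effectivity is hidden in a primitive: in particular kernels, normal forms
  and lattice membership are not primitives and have to be programmed. Unbounded \<open>While\<close> makes
  termination part of what a decidability claim asserts.

  Reading outside a matrix gives 0, writing outside does nothing, sums and products of matrices of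
  incompatible sizes are the empty matrix. Truth values are 0 and nonzero. Division is \<open>div\<close> on
  \<open>int\<close>, with \<open>x div 0 = 0\<close>.\<close>

type_synonym state = "(nat \<Rightarrow> int) \<times> (nat \<Rightarrow> int mat)"

datatype iexp =
    IConst int
  | IReg nat
  | IRows nat
  | ICols nat
  | IEntry nat iexp iexp
  | IAdd iexp iexp
  | ISub iexp iexp
  | IMul iexp iexp
  | IDiv iexp iexp
  | ILess iexp iexp

datatype mexp =
    MReg nat
  | MZero iexp iexp
  | MTranspose mexp
  | MAdd mexp mexp
  | MMul mexp mexp

datatype prog =
    Skip
  | SetInt nat iexp
  | SetMat nat mexp
  | SetEntry nat iexp iexp iexp
  | Seq prog prog
  | If iexp prog prog
  | While iexp prog

definition mat_get :: "int mat \<Rightarrow> int \<Rightarrow> int \<Rightarrow> int" where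
  "mat_get A i j =
     (if 0 \<le> i \<and> i < int (dim_row A) \<and> 0 \<le> j \<and> j < int (dim_col A) then A $$ (nat i, nat j) else 0)"

definition mat_put :: "int mat \<Rightarrow> int \<Rightarrow> int \<Rightarrow> int \<Rightarrow> int mat" where
  "mat_put A i j x =
     mat (dim_row A) (dim_col A) (\<lambda>(a, b). if int a = i \<and> int b = j then x else A $$ (a, b))"

primrec ieval :: "iexp \<Rightarrow> state \<Rightarrow> int" where
  "ieval (IConst x) st = x"
| "ieval (IReg r) st = fst st r"
| "ieval (IRows m) st = int (dim_row (snd st m))"
| "ieval (ICols m) st = int (dim_col (snd st m))"
| "ieval (IEntry m e f) st = mat_get (snd st m) (ieval e st) (ieval f st)"
| "ieval (IAdd e f) st = ieval e st + ieval f st"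
| "ieval (ISub e f) st = ieval e st - ieval f st"
| "ieval (IMul e f) st = ieval e st * ieval f st"
| "ieval (IDiv e f) st = ieval e st div ieval f st"
| "ieval (ILess e f) st = of_bool (ieval e st < ieval f st)"

primrec meval :: "mexp \<Rightarrow> state \<Rightarrow> int mat" where
  "meval (MReg m) st = snd st m"
| "meval (MZero e f) st = 0\<^sub>m (nat (ieval e st)) (nat (ieval f st))"
| "meval (MTranspose a) st = transpose_mat (meval a st)"
| "meval (MAdd a b) st =
     (if dim_row (meval a st) = dim_row (meval b st) \<and> dim_col (meval a st) = dim_col (meval b st)
      then meval a st + meval b st else 0\<^sub>m 0 0)"
| "meval (MMul a b) st =
     (if dim_col (meval a st) = dim_row (meval b st) then meval a st * meval b st else 0\<^sub>m 0 0)"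

text \<open>\<open>exec p st st'\<close>: started in \<open>st\<close>, the (deterministic) program \<open>p\<close> terminates in \<open>st'\<close>.\<close>

inductive exec :: "prog \<Rightarrow> state \<Rightarrow> state \<Rightarrow> bool" where
  exec_Skip: "exec Skip st st"
| exec_SetInt: "exec (SetInt r e) st ((fst st)(r := ieval e st), snd st)"
| exec_SetMat: "exec (SetMat m a) st (fst st, (snd st)(m := meval a st))"
| exec_SetEntry: "exec (SetEntry m e f g) st
     (fst st, (snd st)(m := mat_put (snd st m) (ieval e st) (ieval f st) (ieval g st)))"
| exec_Seq: "exec p st st' \<Longrightarrow> exec q st' st'' \<Longrightarrow> exec (Seq p q) st st''"
| exec_IfTrue: "ieval e st \<noteq> 0 \<Longrightarrow> exec p st st' \<Longrightarrow> exec (If e p q) st st'"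
| exec_IfFalse: "ieval e st = 0 \<Longrightarrow> exec q st st' \<Longrightarrow> exec (If e p q) st st'"
| exec_WhileFalse: "ieval e st = 0 \<Longrightarrow> exec (While e p) st st"
| exec_WhileTrue:
    "ieval e st \<noteq> 0 \<Longrightarrow> exec p st st' \<Longrightarrow> exec (While e p) st' st'' \<Longrightarrow> exec (While e p) st st''"

text \<open>The explicit data: a group on \<open>{0, \<dots>, k - 1}\<close> is given by its \<open>k \<times> k\<close> multiplication table, the
  subgroups \<open>H 1, \<dots>, H N\<close> by the \<open>N \<times> k\<close> matrix of their indicator vectors.\<close>

definition is_mult_table :: "nat monoid \<Rightarrow> int mat \<Rightarrow> bool" where
  "is_mult_table G T \<longleftrightarrow>
     (\<exists>k. carrier G = {..<k} \<and> T \<in> carrier_mat k k \<and>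
          (\<forall>i<k. \<forall>j<k. T $$ (i, j) = int (i \<otimes>\<^bsub>G\<^esub> j)))"

definition is_subgroup_table :: "nat monoid \<Rightarrow> (nat \<Rightarrow> nat set) \<Rightarrow> nat \<Rightarrow> int mat \<Rightarrow> bool" where
  "is_subgroup_table G H N M \<longleftrightarrow>
     M \<in> carrier_mat N (card (carrier G)) \<and>
     (\<forall>a\<in>{1..N}. \<forall>x<card (carrier G). M $$ (a - 1, x) = of_bool (x \<in> H a))"

definition input_state :: "int mat \<Rightarrow> int mat \<Rightarrow> nat \<Rightarrow> state" where
  "input_state T M n = ((\<lambda>_. 0)(0 := int n), (\<lambda>_. 0\<^sub>m 0 0)(0 := T, 1 := M))"

text \<open>\<open>answers p st b\<close>: on input \<open>st\<close>, \<open>p\<close> terminates and returns the truth value \<open>b\<close> in integer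
  register 0.\<close>

definition answers :: "prog \<Rightarrow> state \<Rightarrow> bool \<Rightarrow> bool" where
  "answers p st b \<longleftrightarrow> (\<exists>st'. exec p st st' \<and> fst st' 0 = of_bool b)"

end

theory Submission
  imports Defs
begin

text \<open>
  The cokernel of \<open>R\<^sub>n\<close> is isomorphic to the kernel of \<open>\<phi>\<^sub>n\<close>. Evaluating 2-cycles on the extension cocycle gives
  \<open>\<theta>: Z\<^sub>2(Q\<^sub>n) \<rightarrow> C\<^sub>n\<close> with \<open>\<vartheta> = \<phi>\<^sub>n \<circ> \<theta>\<close>, and the five-term sequence says that \<open>ker \<theta>\<close> is the image of
  \<open>R\<^sub>n\<close> while the image of \<open>\<theta>\<close> is \<open>C\<^sub>n \<inter> [E\<^sub>n, E\<^sub>n]\<close>. The latter contains \<open>ker \<phi>\<^sub>n\<close>, because products of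
  two augmentation elements die in \<open>H\<^sub>1(E\<^sub>n)\<close>.

  For the algorithm, \<open>|G|\<^sup>n A\<^sub>1 \<subseteq> A\<^sub>n\<^sub>+\<^sub>1\<close>, so that \<open>h - 1 \<in> A\<^sub>n\<^sub>+\<^sub>1\<close> can be tested modulo \<open>|G|\<^sup>n\<close>, that is in a
  finite module. There \<open>h - 1 \<notin> A\<^sub>n\<^sub>+\<^sub>1\<close> is witnessed by a family of subsets with the closure properties
  of \<open>A\<^sub>0, \<dots>, A\<^sub>n\<^sub>+\<^sub>1\<close> whose last member misses \<open>h - 1\<close>. Families of subsets are integers below an
  explicit bound, and bounded search is programmable.
\<close>

section \<open>Normalized bar chains and central extensions\<close>

text \<open>Normal forms, kernels and lattice membership would all have to be programmed and
  verified here, which is why the second claim is settled by enumeration. The bridge is the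
  condition \<open>\<forall>h\<in>H n. aug G h \<in> filt G H (Suc n) \<longrightarrow> h \<in> H
  (Suc n)\<close>: it characterizes triviality of the cokernel as well as injectivity of
  \<open>phi\<close>, and it mentions neither bar chains nor the section, so the program only reads
  the two tables. Reduction modulo |G|^n loses nothing on elements of augmentation 0: if two of them
  differ by |G|^n r, then r itself has augmentation 0, hence lies in A_1, and the n factors |G| move
  it from A_1 down to A_{n+1}. It is non-membership that gets a certificate, because a closed family
  of subsets of a finite module is an object of known size whose defining properties are checked
  element by element, and every such family contains the images of A_0, ..., A_{n+1}.\<close>

lemma keys_minusI: "\<lbrakk>Poly_Mapping.keys a \<subseteq> S; Poly_Mapping.keys b \<subseteq> S\<rbrakk> \<Longrightarrow> Poly_Mapping.keys (a - b) \<subseteq> S"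
  using keys_diff by fastforce

lemma keys_plusI: "\<lbrakk>Poly_Mapping.keys a \<subseteq> S; Poly_Mapping.keys b \<subseteq> S\<rbrakk> \<Longrightarrow> Poly_Mapping.keys (a + b) \<subseteq> S"
  using Poly_Mapping.keys_add by fastforce

lemma keys_frag_extendI:
  assumes "Poly_Mapping.keys c \<subseteq> S" "\<And>x. x \<in> S \<Longrightarrow> Poly_Mapping.keys (f x) \<subseteq> T"
  shows "Poly_Mapping.keys (frag_extend f c) \<subseteq> T"
  using keys_frag_extend[of f c] assms by blast

lemma bar_chains_iff [simp]: "c \<in> carrier (bar_chains Q r) \<longleftrightarrow> Poly_Mapping.keys c \<subseteq> bar_basis Q r"
  by (simp add: bar_chains_def)

lemma group_bar_chains [simp]: "group (bar_chains Q r)"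
  by (simp add: bar_chains_def)

lemma bar_chains_simps [simp]:
  "\<one>\<^bsub>bar_chains Q r\<^esub> = 0" "x \<otimes>\<^bsub>bar_chains Q r\<^esub> y = x + y"
  by (simp_all add: bar_chains_def)

lemma keys_bar_sym: "set qs \<subseteq> carrier Q \<Longrightarrow> length qs = r \<Longrightarrow> Poly_Mapping.keys (bar_sym Q qs) \<subseteq> bar_basis Q r"
  by (auto simp: bar_sym_def bar_basis_def)

lemma bar_sym_one [simp]: "bar_sym Q (\<one>\<^bsub>Q\<^esub> # qs) = 0"
  by (simp add: bar_sym_def)

lemma frag_of_bar_basis: "qs \<in> bar_basis Q r \<Longrightarrow> frag_of qs = bar_sym Q qs"
  by (auto simp: bar_sym_def bar_basis_def)

lemma bar_basis_1E:
  assumes "qs \<in> bar_basis Q 1" obtains x where "qs = [x]" "x \<in> carrier Q" "x \<noteq> \<one>\<^bsub>Q\<^esub>"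
  using assms by (auto simp: bar_basis_def length_Suc_conv)

lemma bar_basis_2E:
  assumes "qs \<in> bar_basis Q 2" obtains x y where "qs = [x, y]" "x \<in> carrier Q" "y \<in> carrier Q"
    "x \<noteq> \<one>\<^bsub>Q\<^esub>" "y \<noteq> \<one>\<^bsub>Q\<^esub>"
proof -
  from assms have "length qs = Suc (Suc 0)" by (simp add: bar_basis_def)
  then obtain x y where "qs = [x, y]" by (auto simp: length_Suc_conv)
  with assms show ?thesis by (intro that) (auto simp: bar_basis_def)
qed

lemma bar_basis_3E:
  assumes "qs \<in> bar_basis Q 3" obtains x y z where "qs = [x, y, z]" "x \<in> carrier Q" "y \<in> carrier Q" "z \<in> carrier Q"
    "x \<noteq> \<one>\<^bsub>Q\<^esub>" "y \<noteq> \<one>\<^bsub>Q\<^esub>" "z \<noteq> \<one>\<^bsub>Q\<^esub>"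
proof -
  from assms have "length qs = Suc (Suc (Suc 0))" by (simp add: bar_basis_def)
  then obtain x y z where "qs = [x, y, z]" by (auto simp: length_Suc_conv)
  with assms show ?thesis by (intro that) (auto simp: bar_basis_def)
qed

lemma bar_bd_diff: "bar_bd Q (a - b) = bar_bd Q a - bar_bd Q b"
  and bar_bd_add: "bar_bd Q (a + b) = bar_bd Q a + bar_bd Q b"
  and bar_bd_zero [simp]: "bar_bd Q 0 = 0"
  by (simp_all add: bar_bd_def frag_extend_diff frag_extend_add)

lemma bar_map_diff: "bar_map Q f (a - b) = bar_map Q f a - bar_map Q f b"
  and bar_map_add: "bar_map Q f (a + b) = bar_map Q f a + bar_map Q f b"
  and bar_map_zero [simp]: "bar_map Q f 0 = 0"
  by (simp_all add: bar_map_def frag_extend_diff frag_extend_add)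

section \<open>Boundaries in degrees 2 and 3\<close>

lemma bar_bd_2:
  assumes "group Q" "x \<in> carrier Q" "y \<in> carrier Q"
  shows "bar_bd Q (bar_sym Q [x, y]) = bar_sym Q [y] - bar_sym Q [x \<otimes>\<^bsub>Q\<^esub> y] + bar_sym Q [x]"
proof -
  interpret group Q by fact
  have *: "{1..<2} = {1::nat}" by auto
  have "bar_bd Q (frag_of [x, y]) = bar_sym Q [y] - bar_sym Q [x \<otimes>\<^bsub>Q\<^esub> y] + bar_sym Q [x]"
    by (simp add: bar_bd_def bar_merge_def * del: One_nat_def)
  moreover have "bar_bd Q (bar_sym Q [\<one>\<^bsub>Q\<^esub>, y]) = 0" "bar_bd Q (bar_sym Q [x, \<one>\<^bsub>Q\<^esub>]) = 0"
    "bar_sym Q [\<one>\<^bsub>Q\<^esub>] = 0"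
    by (simp_all add: bar_sym_def)
  ultimately show ?thesis
    using assms(2,3) by (cases "x = \<one>\<^bsub>Q\<^esub>"; cases "y = \<one>\<^bsub>Q\<^esub>") (simp_all add: bar_sym_def[of Q "[x, y]"])
qed

lemma bar_bd_3:
  assumes "x \<noteq> \<one>\<^bsub>Q\<^esub>" "y \<noteq> \<one>\<^bsub>Q\<^esub>" "z \<noteq> \<one>\<^bsub>Q\<^esub>"
  shows "bar_bd Q (frag_of [x, y, z]) =
    bar_sym Q [y, z] - bar_sym Q [x \<otimes>\<^bsub>Q\<^esub> y, z] + bar_sym Q [x, y \<otimes>\<^bsub>Q\<^esub> z] - bar_sym Q [x, y]"
proof -
  have [simp]: "{Suc 0..<3} = {Suc 0, 2}" by auto
  show ?thesis
    by (simp add: bar_bd_def bar_merge_def numeral_2_eq_2)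
qed

lemma keys_bar_bd_2:
  assumes "group Q" "Poly_Mapping.keys c \<subseteq> bar_basis Q 2"
  shows "Poly_Mapping.keys (bar_bd Q c) \<subseteq> bar_basis Q 1"
proof -
  interpret group Q by fact
  show ?thesis using assms(2)
  proof (induction c rule: frag_induction)
    case (one qs)
    then obtain x y where "qs = [x, y]" "x \<in> carrier Q" "y \<in> carrier Q"
      by (auto elim: bar_basis_2E)
    with one show ?case
      by (simp add: frag_of_bar_basis bar_bd_2 assms(1) keys_plusI keys_minusI keys_bar_sym)
  qed (simp_all add: bar_bd_diff keys_minusI)
qed

lemma keys_bar_bd_3:
  assumes "group Q" "Poly_Mapping.keys c \<subseteq> bar_basis Q 3"
  shows "Poly_Mapping.keys (bar_bd Q c) \<subseteq> bar_basis Q 2"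
proof -
  interpret group Q by fact
  show ?thesis using assms(2)
  proof (induction c rule: frag_induction)
    case (one qs)
    then obtain x y z where "qs = [x, y, z]" "x \<in> carrier Q" "y \<in> carrier Q" "z \<in> carrier Q"
       "x \<noteq> \<one>\<^bsub>Q\<^esub>" "y \<noteq> \<one>\<^bsub>Q\<^esub>" "z \<noteq> \<one>\<^bsub>Q\<^esub>"
      by (auto elim: bar_basis_3E)
    then show ?case
      by (simp add: bar_bd_3 keys_plusI keys_minusI keys_bar_sym)
  qed (simp_all add: bar_bd_diff keys_minusI)
qed

lemma Z2_iff: "z \<in> Z2 Q \<longleftrightarrow> Poly_Mapping.keys z \<subseteq> bar_basis Q 2 \<and> bar_bd Q z = 0"
  by (auto simp: Z2_def kernel_def)

text \<open>The additive quotient of \<open>bar_chains E 1\<close> by \<open>B1 E\<close> is the abelianization of \<open>E\<close>.\<close>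

definition B1 :: "('q, 'b) monoid_scheme \<Rightarrow> ('q list \<Rightarrow>\<^sub>0 int) set" where
  "B1 Q = bar_bd Q ` carrier (bar_chains Q 2)"

lemma B1_diff: "a \<in> B1 Q \<Longrightarrow> b \<in> B1 Q \<Longrightarrow> a - b \<in> B1 Q"
  unfolding B1_def by (auto simp: bar_bd_diff[symmetric] keys_minusI simp del: bar_chains_iff intro!: imageI)
     (simp add: keys_minusI)

lemma B1_zero: "0 \<in> B1 Q"
  unfolding B1_def by (auto intro!: image_eqI[of _ _ 0])

lemma B1_sym:
  assumes "group Q" "x \<in> carrier Q" "y \<in> carrier Q"
  shows "bar_sym Q [x \<otimes>\<^bsub>Q\<^esub> y] - bar_sym Q [x] - bar_sym Q [y] \<in> B1 Q"
proof -
  have "bar_bd Q (bar_sym Q [x, y]) \<in> B1 Q"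
    unfolding B1_def using assms by (intro imageI) (auto intro!: keys_bar_sym[THEN subsetD])
  then have "0 - bar_bd Q (bar_sym Q [x, y]) \<in> B1 Q" by (intro B1_diff B1_zero)
  then show ?thesis by (simp add: bar_bd_2 assms algebra_simps)
qed

section \<open>Central extensions with a normalized section\<close>

lemma (in comm_group) inv_cancel_middle:
  assumes "a \<in> carrier G" "b \<in> carrier G" "c \<in> carrier G"
  shows "c \<otimes> inv (a \<otimes> (b \<otimes> c)) \<otimes> b = inv a"
proof -
  have "c \<otimes> (x \<otimes> (y \<otimes> z)) \<otimes> b = x \<otimes> ((b \<otimes> y) \<otimes> (c \<otimes> z))"
    if "x \<in> carrier G" "y \<in> carrier G" "z \<in> carrier G" for x y z
    using assms that by (simp add: m_ac)
  from this[of "inv a" "inv b" "inv c"] show ?thesis using assms by (simp add: inv_mult)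
qed

text \<open>The five-term argument uses only centrality of the kernel, so it is carried out for an
  arbitrary central extension. Surjectivity of \<open>p\<close> is contained in
  \<open>p_s\<close>.\<close>

locale central_ext =
  fixes E :: "'e monoid" and Q :: "'q monoid" and p :: "'e \<Rightarrow> 'q" and s :: "'q \<Rightarrow> 'e"
  assumes group_E: "group E" and group_Q: "group Q" and p_hom: "p \<in> hom E Q"
    and s_closed [simp]: "q \<in> carrier Q \<Longrightarrow> s q \<in> carrier E"
    and p_s [simp]: "q \<in> carrier Q \<Longrightarrow> p (s q) = q"
    and s_one [simp]: "s \<one>\<^bsub>Q\<^esub> = \<one>\<^bsub>E\<^esub>"
    and central: "\<lbrakk>c \<in> carrier E; p c = \<one>\<^bsub>Q\<^esub>; x \<in> carrier E\<rbrakk> \<Longrightarrow> c \<otimes>\<^bsub>E\<^esub> x = x \<otimes>\<^bsub>E\<^esub> c"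
begin

sublocale E: group E by (rule group_E)
sublocale Q: group Q by (rule group_Q)
sublocale p: group_hom E Q p by unfold_locales (rule p_hom)

definition K where "K = {c \<in> carrier E. p c = \<one>\<^bsub>Q\<^esub>}"
definition Kg where "Kg = E\<lparr>carrier := K\<rparr>"
definition al where "al q q' = s q \<otimes>\<^bsub>E\<^esub> s q' \<otimes>\<^bsub>E\<^esub> inv\<^bsub>E\<^esub> (s (q \<otimes>\<^bsub>Q\<^esub> q'))"
text \<open>The kernel component in the decomposition of x as a kernel element times
  \<open>s (p x)\<close>. It is a set-theoretic retraction of \<open>E\<close> onto \<open>K\<close>
  whose failure to be multiplicative is the cocycle \<open>al\<close>.\<close>

definition defect where "defect x = x \<otimes>\<^bsub>E\<^esub> inv\<^bsub>E\<^esub> (s (p x))"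

lemma Kg_simps [simp]: "carrier Kg = K" "\<one>\<^bsub>Kg\<^esub> = \<one>\<^bsub>E\<^esub>" "x \<otimes>\<^bsub>Kg\<^esub> y = x \<otimes>\<^bsub>E\<^esub> y"
  by (simp_all add: Kg_def)

lemma K_subgroup: "subgroup K E"
  by unfold_locales (auto simp: K_def)

lemma Kg_comm: "comm_group Kg"
  unfolding Kg_def
  by (rule group.group_comm_groupI[OF E.subgroup_imp_group[OF K_subgroup]]) (auto simp: K_def central)

sublocale Kg: comm_group Kg by (rule Kg_comm)

lemma Kg_inv [simp]: "x \<in> K \<Longrightarrow> inv\<^bsub>Kg\<^esub> x = inv\<^bsub>E\<^esub> x"
  unfolding Kg_def by (rule E.m_inv_consistent[OF K_subgroup])

lemma al_closed [simp]: "q \<in> carrier Q \<Longrightarrow> q' \<in> carrier Q \<Longrightarrow> al q q' \<in> K"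
  by (auto simp: al_def K_def)

lemma al_mult: "\<lbrakk>q \<in> carrier Q; q' \<in> carrier Q\<rbrakk> \<Longrightarrow> s q \<otimes>\<^bsub>E\<^esub> s q' = al q q' \<otimes>\<^bsub>E\<^esub> s (q \<otimes>\<^bsub>Q\<^esub> q')"
  by (simp add: al_def E.m_assoc)

lemma al_one [simp]: "q \<in> carrier Q \<Longrightarrow> al \<one>\<^bsub>Q\<^esub> q = \<one>\<^bsub>E\<^esub>" "q \<in> carrier Q \<Longrightarrow> al q \<one>\<^bsub>Q\<^esub> = \<one>\<^bsub>E\<^esub>"
  by (simp_all add: al_def)

lemma defect_closed [simp]: "x \<in> carrier E \<Longrightarrow> defect x \<in> K"
  by (simp add: defect_def K_def)

lemma defect_K: "x \<in> K \<Longrightarrow> defect x = x"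
  by (auto simp: defect_def K_def)

lemma defect_one [simp]: "defect \<one>\<^bsub>E\<^esub> = \<one>\<^bsub>E\<^esub>"
  by (simp add: defect_def)

lemma defect_mult: "x \<in> carrier E \<Longrightarrow> x = defect x \<otimes>\<^bsub>E\<^esub> s (p x)"
  by (simp add: defect_def E.m_assoc)

lemma K_carrier: "x \<in> K \<Longrightarrow> x \<in> carrier E" by (simp add: K_def)

lemma K_left_commute:
  assumes "c \<in> K" "x \<in> carrier E" "y \<in> carrier E"
  shows "x \<otimes>\<^bsub>E\<^esub> (c \<otimes>\<^bsub>E\<^esub> y) = c \<otimes>\<^bsub>E\<^esub> (x \<otimes>\<^bsub>E\<^esub> y)"
  using assms central[of c x] by (simp add: K_def E.m_assoc[symmetric])

text \<open>Associativity of the product of \<open>s q\<close>, \<open>s q'\<close> and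
  \<open>s q''\<close>, with all kernel factors moved to the left by centrality.\<close>

lemma cocycle:
  assumes q: "q \<in> carrier Q" "q' \<in> carrier Q" "q'' \<in> carrier Q"
  shows "al q q' \<otimes>\<^bsub>E\<^esub> al (q \<otimes>\<^bsub>Q\<^esub> q') q'' = al q' q'' \<otimes>\<^bsub>E\<^esub> al q (q' \<otimes>\<^bsub>Q\<^esub> q'')"
proof -
  let ?t = "s (q \<otimes>\<^bsub>Q\<^esub> q' \<otimes>\<^bsub>Q\<^esub> q'')"
  have "al q q' \<otimes>\<^bsub>E\<^esub> al (q \<otimes>\<^bsub>Q\<^esub> q') q'' \<otimes>\<^bsub>E\<^esub> ?t = s q \<otimes>\<^bsub>E\<^esub> s q' \<otimes>\<^bsub>E\<^esub> s q''"
    using q by (simp add: al_mult E.m_assoc K_carrier)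
  also have "\<dots> = s q \<otimes>\<^bsub>E\<^esub> (s q' \<otimes>\<^bsub>E\<^esub> s q'')"
    using q by (simp add: E.m_assoc)
  also have "\<dots> = al q' q'' \<otimes>\<^bsub>E\<^esub> al q (q' \<otimes>\<^bsub>Q\<^esub> q'') \<otimes>\<^bsub>E\<^esub> ?t"
  proof -
    have "s q \<otimes>\<^bsub>E\<^esub> (al q' q'' \<otimes>\<^bsub>E\<^esub> s (q' \<otimes>\<^bsub>Q\<^esub> q'')) = al q' q'' \<otimes>\<^bsub>E\<^esub> (s q \<otimes>\<^bsub>E\<^esub> s (q' \<otimes>\<^bsub>Q\<^esub> q''))"
      using q by (intro K_left_commute) auto
    then show ?thesis using q by (simp add: al_mult E.m_assoc K_carrier Q.m_assoc)
  qed
  finally show ?thesis using q by (simp add: K_carrier)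
qed

text \<open>Pulled back to \<open>E\<close>, the extension splits: the cocycle becomes the
  coboundary of the cochain \<open>defect\<close>. This is the source of all vanishing of
  \<open>theta\<close> on chains coming from \<open>E\<close>.\<close>

lemma defect_product:
  assumes x: "x \<in> carrier E" "y \<in> carrier E"
  shows "al (p x) (p y) \<otimes>\<^bsub>E\<^esub> (defect x \<otimes>\<^bsub>E\<^esub> defect y) = defect (x \<otimes>\<^bsub>E\<^esub> y)"
proof -
  let ?t = "s (p x \<otimes>\<^bsub>Q\<^esub> p y)"
  have "defect (x \<otimes>\<^bsub>E\<^esub> y) \<otimes>\<^bsub>E\<^esub> ?t = x \<otimes>\<^bsub>E\<^esub> y"
    using x defect_mult[of "x \<otimes>\<^bsub>E\<^esub> y"] by simp
  also have "\<dots> = (defect x \<otimes>\<^bsub>E\<^esub> s (p x)) \<otimes>\<^bsub>E\<^esub> (defect y \<otimes>\<^bsub>E\<^esub> s (p y))"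
    using x defect_mult[of x] defect_mult[of y] by simp
  also have "\<dots> = defect x \<otimes>\<^bsub>E\<^esub> (defect y \<otimes>\<^bsub>E\<^esub> (s (p x) \<otimes>\<^bsub>E\<^esub> s (p y)))"
    using x by (simp add: E.m_assoc K_carrier K_left_commute)
  also have "\<dots> = al (p x) (p y) \<otimes>\<^bsub>E\<^esub> (defect x \<otimes>\<^bsub>E\<^esub> defect y) \<otimes>\<^bsub>E\<^esub> ?t"
    using x by (simp add: E.m_assoc K_carrier K_left_commute al_mult)
  finally show ?thesis using x by (simp add: K_carrier)
qed

text \<open>The target is a multiplicative group of cosets, outside the range of
  \<open>frag_extend\<close>, so the linear extension of the cocycle to all 2-chains is picked from
  the universal property.\<close>

definition theta where
  "theta = (SOME h. h \<in> hom (bar_chains Q 2) Kg \<and> (\<forall>x\<in>bar_basis Q 2. h (frag_of x) = al (x ! 0) (x ! 1)))"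

definition defect1 where
  "defect1 = (SOME h. h \<in> hom (bar_chains E 1) Kg \<and> (\<forall>x\<in>bar_basis E 1. h (frag_of x) = defect (x ! 0)))"

lemma theta: "theta \<in> hom (bar_chains Q 2) Kg" "\<And>x. x \<in> bar_basis Q 2 \<Longrightarrow> theta (frag_of x) = al (x ! 0) (x ! 1)"
proof -
  have "(\<lambda>x. al (x ! 0) (x ! 1)) ` bar_basis Q 2 \<subseteq> carrier Kg"
    by (auto elim!: bar_basis_2E)
  then have "\<exists>h. h \<in> hom (bar_chains Q 2) Kg \<and> (\<forall>x\<in>bar_basis Q 2. h (frag_of x) = al (x ! 0) (x ! 1))"
    unfolding bar_chains_def by (rule Kg.free_Abelian_group_universal) blast
  from someI_ex[OF this] show "theta \<in> hom (bar_chains Q 2) Kg"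
    "\<And>x. x \<in> bar_basis Q 2 \<Longrightarrow> theta (frag_of x) = al (x ! 0) (x ! 1)"
    unfolding theta_def by auto
qed

lemma defect1: "defect1 \<in> hom (bar_chains E 1) Kg" "\<And>x. x \<in> bar_basis E 1 \<Longrightarrow> defect1 (frag_of x) = defect (x ! 0)"
proof -
  have "(\<lambda>x. defect (x ! 0)) ` bar_basis E 1 \<subseteq> carrier Kg"
    by (auto elim!: bar_basis_1E[unfolded One_nat_def])
  then have "\<exists>h. h \<in> hom (bar_chains E 1) Kg \<and> (\<forall>x\<in>bar_basis E 1. h (frag_of x) = defect (x ! 0))"
    unfolding bar_chains_def by (rule Kg.free_Abelian_group_universal) blast
  from someI_ex[OF this] show "defect1 \<in> hom (bar_chains E 1) Kg"
    "\<And>x. x \<in> bar_basis E 1 \<Longrightarrow> defect1 (frag_of x) = defect (x ! 0)"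
    unfolding defect1_def by auto
qed

sublocale theta: group_hom "bar_chains Q 2" Kg theta
  by (intro group_hom.intro group_hom_axioms.intro theta group_bar_chains Kg.is_group)
sublocale defect1: group_hom "bar_chains E 1" Kg defect1
  by (intro group_hom.intro group_hom_axioms.intro defect1 group_bar_chains Kg.is_group)

lemma theta_zero [simp]: "theta 0 = \<one>\<^bsub>E\<^esub>"
  using theta.hom_one by simp

lemma defect1_zero [simp]: "defect1 0 = \<one>\<^bsub>E\<^esub>"
  using defect1.hom_one by simp

lemma bar_chains_inv: "Poly_Mapping.keys x \<subseteq> bar_basis A r \<Longrightarrow> inv\<^bsub>bar_chains A r\<^esub> x = - x"
  unfolding bar_chains_def by simp

lemma theta_closed: "Poly_Mapping.keys a \<subseteq> bar_basis Q 2 \<Longrightarrow> theta a \<in> K"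
  using theta.hom_closed[of a] by simp

lemma defect1_closed: "Poly_Mapping.keys a \<subseteq> bar_basis E 1 \<Longrightarrow> defect1 a \<in> K"
  using defect1.hom_closed[of a] by simp

lemma theta_add: "\<lbrakk>Poly_Mapping.keys a \<subseteq> bar_basis Q 2; Poly_Mapping.keys b \<subseteq> bar_basis Q 2\<rbrakk> \<Longrightarrow>
   theta (a + b) = theta a \<otimes>\<^bsub>E\<^esub> theta b"
  using theta.hom_mult[of a b] by simp

lemma theta_diff: "\<lbrakk>Poly_Mapping.keys a \<subseteq> bar_basis Q 2; Poly_Mapping.keys b \<subseteq> bar_basis Q 2\<rbrakk> \<Longrightarrow>
   theta (a - b) = theta a \<otimes>\<^bsub>E\<^esub> inv\<^bsub>E\<^esub> theta b"
  using theta_add[of a "- b"] theta.hom_inv[of b] theta_closed[of b] by (simp add: bar_chains_inv)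

lemma defect1_add: "\<lbrakk>Poly_Mapping.keys a \<subseteq> bar_basis E 1; Poly_Mapping.keys b \<subseteq> bar_basis E 1\<rbrakk> \<Longrightarrow>
   defect1 (a + b) = defect1 a \<otimes>\<^bsub>E\<^esub> defect1 b"
  using defect1.hom_mult[of a b] by simp

lemma defect1_diff: "\<lbrakk>Poly_Mapping.keys a \<subseteq> bar_basis E 1; Poly_Mapping.keys b \<subseteq> bar_basis E 1\<rbrakk> \<Longrightarrow>
   defect1 (a - b) = defect1 a \<otimes>\<^bsub>E\<^esub> inv\<^bsub>E\<^esub> defect1 b"
  using defect1_add[of a "- b"] defect1.hom_inv[of b] defect1_closed[of b] by (simp add: bar_chains_inv)

lemma theta_sym: "\<lbrakk>x \<in> carrier Q; y \<in> carrier Q\<rbrakk> \<Longrightarrow> theta (bar_sym Q [x, y]) = al x y"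
  using theta(2)[of "[x, y]"] by (auto simp: bar_sym_def bar_basis_def)

lemma defect1_sym: "x \<in> carrier E \<Longrightarrow> defect1 (bar_sym E [x]) = defect x"
  using defect1(2)[of "[x]"] by (auto simp: bar_sym_def bar_basis_def)

section \<open>Values of \<open>theta\<close> on images and boundaries, and exactness\<close>

lemma bar_map_sym:
  assumes "set es \<subseteq> carrier E"
  shows "bar_map Q p (bar_sym E es) = bar_sym Q (map p es)"
proof (cases "\<one>\<^bsub>E\<^esub> \<in> set es")
  case True
  then have "\<one>\<^bsub>Q\<^esub> \<in> p ` set es" using p.hom_one by (metis imageI)
  with True show ?thesis by (simp add: bar_map_def bar_sym_def)
qed (simp add: bar_map_def bar_sym_def)

lemma keys_bar_map: "Poly_Mapping.keys w \<subseteq> bar_basis E r \<Longrightarrow> Poly_Mapping.keys (bar_map Q p w) \<subseteq> bar_basis Q r"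
  unfolding bar_map_def by (erule keys_frag_extendI, rule keys_bar_sym) (auto simp: bar_basis_def)

text \<open>Chain form of \<open>defect_product\<close>. If w is a cycle, the right side is trivial;
  if w is not, the formula computes \<open>theta\<close> from the boundary of w, which is how
  \<open>theta_surj\<close> uses it.\<close>

lemma theta_bar_map:
  assumes "Poly_Mapping.keys w \<subseteq> bar_basis E 2"
  shows "theta (bar_map Q p w) = inv\<^bsub>E\<^esub> (defect1 (bar_bd E w))"
proof -
  \<comment> \<open>In the \<open>diff\<close> case \<open>frag_induction\<close> provides nothing
    about the supports of the two parts, so the support is made part of the claim.\<close>
  have "Poly_Mapping.keys w \<subseteq> bar_basis E 2 \<and> theta (bar_map Q p w) = inv\<^bsub>E\<^esub> (defect1 (bar_bd E w))"
    using assms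
  proof (induction w rule: frag_induction)
    case (one es)
    then obtain x y where es: "es = [x, y]" and xy: "x \<in> carrier E" "y \<in> carrier E"
      by (auto elim: bar_basis_2E)
    have k: "Poly_Mapping.keys (bar_sym E [u]) \<subseteq> bar_basis E 1" if "u \<in> carrier E" for u
      using that by (auto intro!: keys_bar_sym[THEN subsetD])
    have "defect1 (bar_bd E (bar_sym E [x, y])) = defect y \<otimes>\<^bsub>E\<^esub> inv\<^bsub>E\<^esub> defect (x \<otimes>\<^bsub>E\<^esub> y) \<otimes>\<^bsub>E\<^esub> defect x"
      using xy group_E k by (simp add: bar_bd_2 defect1_add defect1_diff keys_minusI defect1_sym del: One_nat_def)
    also have "\<dots> = inv\<^bsub>E\<^esub> al (p x) (p y)"
    proof -
      have "inv\<^bsub>E\<^esub> defect (x \<otimes>\<^bsub>E\<^esub> y) = inv\<^bsub>Kg\<^esub> (al (p x) (p y) \<otimes>\<^bsub>Kg\<^esub> (defect x \<otimes>\<^bsub>Kg\<^esub> defect y))"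
        using xy by (simp add: defect_product)
      \<comment> \<open>The three factors follow the boundary [y] - [xy] + [x], which is why the
        inverse stands between the two defects.\<close>
      then show ?thesis
        using Kg.inv_cancel_middle[of "al (p x) (p y)" "defect x" "defect y"] xy by simp
    qed
    finally show ?case using one xy
      by (simp add: es frag_of_bar_basis bar_map_sym theta_sym K_carrier keys_bar_sym)
  next
    case (diff a b)
    let ?a = "defect1 (bar_bd E a)" and ?b = "defect1 (bar_bd E b)"
    have K: "?a \<in> K" "?b \<in> K" using diff by (simp_all only: defect1_closed keys_bar_bd_2 group_E)
    have "theta (bar_map Q p (a - b)) = inv\<^bsub>E\<^esub> ?a \<otimes>\<^bsub>E\<^esub> inv\<^bsub>E\<^esub> (inv\<^bsub>E\<^esub> ?b)"
      using diff by (simp add: bar_map_diff theta_diff keys_bar_map)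
    also have "\<dots> = inv\<^bsub>E\<^esub> (?a \<otimes>\<^bsub>E\<^esub> inv\<^bsub>E\<^esub> ?b)"
      using Kg.inv_mult[of ?a "inv\<^bsub>Kg\<^esub> ?b"] K by (simp add: K_subgroup subgroup.m_closed subgroup.m_inv_closed)
    also have "?a \<otimes>\<^bsub>E\<^esub> inv\<^bsub>E\<^esub> ?b = defect1 (bar_bd E (a - b))"
      using diff by (simp only: bar_bd_diff defect1_diff keys_bar_bd_2 group_E)
    finally show ?case using diff by (simp add: keys_minusI)
  qed auto
  then show ?thesis by simp
qed

text \<open>Chain form of \<open>cocycle\<close>; positive and negative faces of [x|y|z] are grouped
  so that they match its two sides.\<close>

lemma theta_bd_3:
  assumes "Poly_Mapping.keys c \<subseteq> bar_basis Q 3"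
  shows "theta (bar_bd Q c) = \<one>\<^bsub>E\<^esub>"
proof -
  have "Poly_Mapping.keys c \<subseteq> bar_basis Q 3 \<and> theta (bar_bd Q c) = \<one>\<^bsub>E\<^esub>"
    using assms
  proof (induction c rule: frag_induction)
    case (one qs)
    then obtain x y z where es: "qs = [x, y, z]" and xy: "x \<in> carrier Q" "y \<in> carrier Q" "z \<in> carrier Q"
       "x \<noteq> \<one>\<^bsub>Q\<^esub>" "y \<noteq> \<one>\<^bsub>Q\<^esub>" "z \<noteq> \<one>\<^bsub>Q\<^esub>"
      by (auto elim: bar_basis_3E)
    have k: "Poly_Mapping.keys (bar_sym Q [u,v]) \<subseteq> bar_basis Q 2" if "u \<in> carrier Q" "v \<in> carrier Q" for u v
      using that by (auto intro!: keys_bar_sym[THEN subsetD])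
    let ?s = "bar_sym Q"
    have "bar_bd Q (frag_of qs) = (?s [y, z] + ?s [x, y \<otimes>\<^bsub>Q\<^esub> z]) - (?s [x, y] + ?s [x \<otimes>\<^bsub>Q\<^esub> y, z])"
      using xy by (simp add: es bar_bd_3)
    then have "theta (bar_bd Q (frag_of qs)) =
       (al y z \<otimes>\<^bsub>E\<^esub> al x (y \<otimes>\<^bsub>Q\<^esub> z)) \<otimes>\<^bsub>E\<^esub> inv\<^bsub>E\<^esub> (al x y \<otimes>\<^bsub>E\<^esub> al (x \<otimes>\<^bsub>Q\<^esub> y) z)"
      using xy by (simp add: k keys_plusI theta_add theta_diff theta_sym)
    also have "\<dots> = \<one>\<^bsub>E\<^esub>"
      using xy by (simp add: cocycle K_carrier)
    finally show ?case using one by simp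
  next
    case (diff a b)
    then show ?case
      by (simp add: bar_bd_diff theta_diff keys_bar_bd_3 group_Q keys_minusI)
  qed auto
  then show ?thesis by simp
qed

text \<open>The hypothesis says that e is trivial in the abelianization of \<open>E\<close>. If [e]
  bounds w, the image of w in \<open>Q\<close> is a cycle because [p e] is degenerate. The inverse
  is the sign in \<open>theta_bar_map\<close>.\<close>

lemma theta_surj:
  assumes e: "e \<in> K" and B: "bar_sym E [e] \<in> B1 E"
  obtains z where "z \<in> Z2 Q" "theta z = inv\<^bsub>E\<^esub> e"
proof -
  obtain w where w: "Poly_Mapping.keys w \<subseteq> bar_basis E 2" "bar_sym E [e] = bar_bd E w"
    using B by (auto simp: B1_def)
  have "bar_bd Q (bar_map Q p w) = bar_map Q p (bar_bd E w)"
    using w(1)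
  proof (induction w rule: frag_induction)
    case (one es)
    then obtain x y where es: "es = [x, y]" and xy: "x \<in> carrier E" "y \<in> carrier E"
      by (auto elim: bar_basis_2E)
    then show ?case using one group_E group_Q
      by (simp add: frag_of_bar_basis bar_map_sym bar_bd_2 bar_map_add bar_map_diff)
  qed (auto simp: bar_map_diff bar_bd_diff)
  also have "\<dots> = 0"
    using e by (simp add: w(2)[symmetric] bar_map_sym K_def)
  finally have "bar_map Q p w \<in> Z2 Q"
    using w(1) by (simp add: Z2_iff keys_bar_map)
  moreover have "theta (bar_map Q p w) = inv\<^bsub>E\<^esub> e"
    using w e by (simp add: theta_bar_map w(2)[symmetric] defect1_sym defect_K K_carrier)
  ultimately show ?thesis by (rule that)
qed

text \<open>Modulo boundaries, a sum of kernel symbols collapses to the symbol of their product. The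
  2-chains needed have kernel entries only, so they become degenerate in \<open>Q\<close>: the
  correction v is invisible there.\<close>

lemma defect1_exact:
  assumes "Poly_Mapping.keys u \<subseteq> (\<lambda>c. [c]) ` (K - {\<one>\<^bsub>E\<^esub>})"
  shows "\<exists>v. Poly_Mapping.keys v \<subseteq> bar_basis E 2 \<and> bar_map Q p v = 0 \<and>
     u - bar_sym E [defect1 u] = bar_bd E v"
proof -
  let ?S = "(\<lambda>c. [c]) ` (K - {\<one>\<^bsub>E\<^esub>})"
  have S: "?S \<subseteq> bar_basis E 1" by (auto simp: bar_basis_def K_carrier)
  have "Poly_Mapping.keys u \<subseteq> ?S \<and> ?thesis"
    using assms
  proof (induction u rule: frag_induction)
    case zero
    show ?case by (auto intro!: exI[of _ 0] simp: bar_sym_def)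
  next
    case (one x)
    then obtain c where c: "x = [c]" "c \<in> K" "c \<noteq> \<one>\<^bsub>E\<^esub>" by auto
    then have "defect1 (frag_of x) = c"
      using defect1(2)[of x] S by (auto simp: defect_K bar_basis_def K_carrier)
    then show ?case using c one by (auto intro!: exI[of _ 0] simp: bar_sym_def)
  next
    case (diff a b)
    then obtain v v' where v: "Poly_Mapping.keys v \<subseteq> bar_basis E 2" "bar_map Q p v = 0"
      "a - bar_sym E [defect1 a] = bar_bd E v"
      and v': "Poly_Mapping.keys v' \<subseteq> bar_basis E 2" "bar_map Q p v' = 0"
      "b - bar_sym E [defect1 b] = bar_bd E v'" and ab: "Poly_Mapping.keys a \<subseteq> ?S" "Poly_Mapping.keys b \<subseteq> ?S"
      by blast
    let ?a = "defect1 a" and ?b = "defect1 b"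
    have ab': "Poly_Mapping.keys a \<subseteq> bar_basis E 1" "Poly_Mapping.keys b \<subseteq> bar_basis E 1"
      using ab S by auto
    then have K: "?a \<in> K" "?b \<in> K" by (simp_all add: defect1_closed)
    let ?d = "?a \<otimes>\<^bsub>E\<^esub> inv\<^bsub>E\<^esub> ?b"
    \<comment> \<open>With d = a/b one has db = a, so the boundary of [d|b] is [b] - [a] + [d],
      which trades [a] - [b] for [d].\<close>
    let ?w = "v - v' - bar_sym E [?d, ?b]"
    have dK: "?d \<in> K" using K by (simp add: K_subgroup subgroup.m_closed subgroup.m_inv_closed)
    then have "Poly_Mapping.keys ?w \<subseteq> bar_basis E 2"
      using K v v' by (simp add: keys_minusI keys_bar_sym K_carrier)
    moreover have "bar_map Q p ?w = 0"
      using v v' K dK by (simp add: bar_map_diff bar_map_sym K_carrier) (simp add: K_def)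
    moreover have "a - b - bar_sym E [?d] = bar_bd E ?w"
      using v(3) v'(3) K dK group_E
      by (simp add: bar_bd_diff bar_bd_add bar_bd_2 K_carrier E.m_assoc v(3)[symmetric] v'(3)[symmetric])
    ultimately show ?case
      using ab ab' by (auto simp: defect1_diff keys_minusI)
  qed
  then show ?thesis by blast
qed

text \<open>A lift of z through the section has boundary -u with u supported on kernel symbols, and
  the product of the entries of u is \<open>theta z\<close>. If this is trivial,
  \<open>defect1_exact\<close> bounds u by a chain that does not change the image in
  \<open>Q\<close>.\<close>

lemma theta_exact:
  assumes z: "z \<in> Z2 Q" and t: "theta z = \<one>\<^bsub>E\<^esub>"
  obtains w where "w \<in> Z2 E" "bar_map Q p w = z"
proof -
  have kz: "Poly_Mapping.keys z \<subseteq> bar_basis Q 2" using z by (simp add: Z2_iff)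
  let ?al = "\<lambda>qs. al (qs ! 0) (qs ! 1)"
  \<comment> \<open>The section is not multiplicative: [s x|s y] has the face [s x s y] instead of
    [s(xy)]. Subtracting [al(x,y)|s(xy)] replaces this face by [s(xy)] at the price of the symbol
    -[al(x,y)], and the subtracted symbol is degenerate in \<open>Q\<close>.\<close>
  define w where "w = frag_extend (\<lambda>qs. bar_sym E [s (qs ! 0), s (qs ! 1)] -
      bar_sym E [?al qs, s (qs ! 0 \<otimes>\<^bsub>Q\<^esub> qs ! 1)]) z"
  define u where "u = frag_extend (\<lambda>qs. bar_sym E [?al qs]) z"
  have kw: "Poly_Mapping.keys w \<subseteq> bar_basis E 2"
    unfolding w_def
    by (rule keys_frag_extendI[OF kz], elim bar_basis_2E, intro keys_minusI keys_bar_sym)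
       (auto simp: K_carrier)
  have ku: "Poly_Mapping.keys u \<subseteq> (\<lambda>c. [c]) ` (K - {\<one>\<^bsub>E\<^esub>})"
    unfolding u_def
    by (rule keys_frag_extendI[OF kz], elim bar_basis_2E) (auto simp: bar_sym_def)
  have ks: "Poly_Mapping.keys (bar_sym E [x]) \<subseteq> bar_basis E 1" if "x \<in> carrier E" for x
    using that by (intro keys_bar_sym) auto
  have 1: "bar_map Q p w = z"
    unfolding w_def using kz
  proof (induction z rule: frag_induction)
    case (one qs)
    then obtain x y where es: "qs = [x, y]" and xy: "x \<in> carrier Q" "y \<in> carrier Q"
      by (auto elim: bar_basis_2E)
    have a: "al x y \<in> K" using xy by simp
    then have "p (al x y) = \<one>\<^bsub>Q\<^esub>" by (simp add: K_def)
    then show ?case using xy a frag_of_bar_basis[OF one, symmetric]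
      by (simp add: es bar_map_diff bar_map_sym K_carrier)
  qed (auto simp: frag_extend_diff bar_map_diff)
  have 2: "bar_bd E w = bar_map E s (bar_bd Q z) - u"
    unfolding w_def u_def using kz
  proof (induction z rule: frag_induction)
    case (one qs)
    then obtain x y where es: "qs = [x, y]" and xy: "x \<in> carrier Q" "y \<in> carrier Q"
      by (auto elim: bar_basis_2E)
    have m: "bar_map E s (bar_sym Q [q]) = bar_sym E [s q]" for q
      by (cases "q = \<one>\<^bsub>Q\<^esub>") (simp_all add: bar_map_def bar_sym_def)
    have "bar_bd Q (frag_of [x, y]) = bar_sym Q [y] - bar_sym Q [x \<otimes>\<^bsub>Q\<^esub> y] + bar_sym Q [x]"
      using frag_of_bar_basis[OF one] xy by (simp add: es bar_bd_2 group_Q)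
    then show ?case using xy group_E
      by (simp add: es bar_bd_diff bar_bd_2 bar_map_add bar_map_diff m K_carrier)
         (simp add: al_mult)
  qed (auto simp: frag_extend_diff bar_map_diff bar_bd_diff)
  have 3: "Poly_Mapping.keys u \<subseteq> bar_basis E 1 \<and> Poly_Mapping.keys z \<subseteq> bar_basis Q 2 \<and> defect1 u = theta z"
    unfolding u_def using kz
  proof (induction z rule: frag_induction)
    case (one qs)
    then obtain x y where es: "qs = [x, y]" and xy: "x \<in> carrier Q" "y \<in> carrier Q"
      by (auto elim: bar_basis_2E)
    have "al x y \<in> K" using xy by simp
    moreover have "theta (frag_of [x, y]) = al x y"
      using theta(2)[OF one] by (simp add: es)
    ultimately show ?case using one xy
      by (simp add: es defect1_sym ks K_carrier defect_K del: One_nat_def)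
  next
    case (diff a b)
    then show ?case by (simp add: frag_extend_diff defect1_diff theta_diff keys_minusI del: One_nat_def)
  qed auto
  obtain v where v: "Poly_Mapping.keys v \<subseteq> bar_basis E 2" "bar_map Q p v = 0"
     "u - bar_sym E [defect1 u] = bar_bd E v"
    using defect1_exact[OF ku] by blast
  have "bar_bd E v = u" using v(3) 3 t by (simp add: bar_sym_def)
  then have "bar_bd E (w + v) = 0"
    using 2 z by (simp add: bar_bd_add Z2_iff)
  then have "w + v \<in> Z2 E" using kw v by (simp add: Z2_iff keys_plusI)
  moreover have "bar_map Q p (w + v) = z" using 1 v by (simp add: bar_map_add)
  ultimately show ?thesis by (rule that)
qed

end

section \<open>The filtration of the group ring and the cokernel\<close>

lemma add_monoid_group_ring: "add_monoid (group_ring G) = free_Abelian_group (carrier G)"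
  by (simp add: group_ring_def free_Abelian_group_def)

abbreviation aug_mult :: "('a, 'b) monoid_scheme \<Rightarrow> 'a \<Rightarrow> ('a \<Rightarrow>\<^sub>0 int) \<Rightarrow> ('a \<Rightarrow>\<^sub>0 int)" where
  "aug_mult G x p \<equiv> aug G x \<otimes>\<^bsub>group_ring G\<^esub> p"

abbreviation aug_prod :: "('a, 'b) monoid_scheme \<Rightarrow> ('a \<times> nat) list \<Rightarrow> ('a \<Rightarrow>\<^sub>0 int)" where
  "aug_prod G ps \<equiv> foldr (\<lambda>(x, a) p. aug_mult G x p) ps \<one>\<^bsub>group_ring G\<^esub>"

abbreviation weight :: "('a \<times> nat) list \<Rightarrow> nat" where
  "weight ps \<equiv> sum_list (map snd ps)"

definition graded :: "(nat \<Rightarrow> 'a set) \<Rightarrow> ('a \<times> nat) list \<Rightarrow> bool" where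
  "graded H ps \<longleftrightarrow> (\<forall>(x, a)\<in>set ps. 1 \<le> a \<and> x \<in> H a)"

lemma graded_simps [simp]: "graded H []" "graded H ((x, a) # ps) \<longleftrightarrow> 1 \<le> a \<and> x \<in> H a \<and> graded H ps"
  by (auto simp: graded_def)

lemma filt_eq: "filt G H m = generate (free_Abelian_group (carrier G)) {aug_prod G ps | ps. graded H ps \<and> m \<le> weight ps}"
  unfolding filt_def add_monoid_group_ring graded_def by (rule refl)

lemma aug_prod_in_filt: "graded H ps \<Longrightarrow> m \<le> weight ps \<Longrightarrow> aug_prod G ps \<in> filt G H m"
  unfolding filt_eq by (rule generate.incl) blast

lemma filt_zero [simp]: "0 \<in> filt G H m"
  using generate.one[of "free_Abelian_group (carrier G)"] by (simp add: filt_eq)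

lemma filt_add: "u \<in> filt G H m \<Longrightarrow> v \<in> filt G H m \<Longrightarrow> u + v \<in> filt G H m"
  using generate.eng[of u "free_Abelian_group (carrier G)" _ v] by (simp add: filt_eq)

lemma one_group_ring: "\<one>\<^bsub>group_ring G\<^esub> = frag_of \<one>\<^bsub>G\<^esub>"
  by (simp add: group_ring_def)

lemma aug_mult_simps:
  "aug_mult G x (a - b) = aug_mult G x a - aug_mult G x b"
  "aug_mult G x (a + b) = aug_mult G x a + aug_mult G x b"
  "aug_mult G x 0 = 0"
  by (simp_all add: group_ring_def frag_extend_diff frag_extend_add aug_def)

lemma frag_cmul_minus: "frag_cmul c (a - b) = frag_cmul c a - frag_cmul c b"
  by (rule poly_mapping_eqI) (simp add: lookup_minus algebra_simps)

lemma aug_mult_cmul: "aug_mult G x (frag_cmul c a) = frag_cmul c (aug_mult G x a)"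
  by (simp add: group_ring_def frag_extend_cmul frag_extend_diff aug_def frag_cmul_minus)

lemma aug_mult_of: "aug_mult G x (frag_of g) = frag_of (x \<otimes>\<^bsub>G\<^esub> g) - frag_of (\<one>\<^bsub>G\<^esub> \<otimes>\<^bsub>G\<^esub> g)"
  by (simp add: group_ring_def aug_def frag_extend_diff)

section \<open>Elementary properties of an N-series and its filtration\<close>

locale N_series_group = group G for G (structure) +
  fixes H :: "nat \<Rightarrow> 'a set"
  assumes series: "N_series G H"
begin

lemma H_1: "H (Suc 0) = carrier G"
  using series by (simp add: N_series_def)

lemma H_subgroup: "1 \<le> a \<Longrightarrow> subgroup (H a) G"
  using series by (simp add: N_series_def)

lemma H_Suc: "1 \<le> a \<Longrightarrow> H (Suc a) \<subseteq> H a"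
  using series by (simp add: N_series_def)

lemma H_anti:
  assumes "1 \<le> a" "a \<le> b" shows "H b \<subseteq> H a"
  using assms(2)
proof (induction b rule: dec_induct)
  case (step b)
  then show ?case using H_Suc[of b] assms(1) by auto
qed simp

lemma H_carrier: "1 \<le> a \<Longrightarrow> x \<in> H a \<Longrightarrow> x \<in> carrier G"
  using H_subgroup subgroup.mem_carrier by metis

lemma H_commutator:
  assumes "1 \<le> a" "1 \<le> b" "x \<in> H a" "y \<in> H b"
  shows "x \<otimes> y \<otimes> inv x \<otimes> inv y \<in> H (a + b)"
proof -
  have "x \<otimes> y \<otimes> inv x \<otimes> inv y \<in> commutator_subgroup G (H a) (H b)"
    unfolding commutator_subgroup_def using assms by (intro generate.incl) blast
  with series assms show ?thesis unfolding N_series_def by blast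
qed

text \<open>As \<open>H 1\<close> is the whole group, the commutator condition for the indices 1 and
  a already gives normality.\<close>

lemma H_normal:
  assumes "1 \<le> a" shows "H a \<lhd> G"
  unfolding normal_inv_iff
proof (intro conjI ballI)
  fix x h assume x: "x \<in> carrier G" and h: "h \<in> H a"
  have "x \<otimes> h \<otimes> inv x \<otimes> inv h \<in> H (1 + a)"
    using assms x h by (intro H_commutator) (auto simp: H_1)
  then have "x \<otimes> h \<otimes> inv x \<otimes> inv h \<in> H a"
    using H_anti[of a "1 + a"] assms by auto
  then have "x \<otimes> h \<otimes> inv x \<otimes> inv h \<otimes> h \<in> H a"
    using H_subgroup[OF assms] h subgroup.m_closed by metis
  then show "x \<otimes> h \<otimes> inv x \<in> H a"
    using x h H_carrier[OF assms] by (simp add: m_assoc)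
qed (rule H_subgroup[OF assms])

lemma keys_aug: "x \<in> carrier G \<Longrightarrow> Poly_Mapping.keys (aug G x) \<subseteq> carrier G"
  unfolding aug_def by (intro keys_minusI) auto

lemma aug_mult_frag_of: "g \<in> carrier G \<Longrightarrow> aug_mult G x (frag_of g) = frag_of (x \<otimes> g) - frag_of g"
  by (simp add: aug_mult_of)

lemma aug_mult_one: "x \<in> carrier G \<Longrightarrow> aug_mult G x (frag_of \<one>) = aug G x"
  by (simp add: aug_mult_of) (simp add: aug_def)

lemma aug_mult_aug: "x \<in> carrier G \<Longrightarrow> y \<in> carrier G \<Longrightarrow> aug_mult G x (aug G y) = aug G (x \<otimes> y) - aug G x - aug G y"
  by (simp add: aug_def[of G y] aug_mult_simps aug_mult_one aug_mult_frag_of) (simp add: aug_def)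

lemma aug_one [simp]: "aug G \<one> = 0"
  by (simp add: aug_def)

lemma keys_aug_mult:
  assumes "x \<in> carrier G" "Poly_Mapping.keys p \<subseteq> carrier G"
  shows "Poly_Mapping.keys (aug_mult G x p) \<subseteq> carrier G"
  using assms(2)
proof (induction p rule: frag_induction)
  case (one g)
  then have "Poly_Mapping.keys (frag_of (x \<otimes> g) - frag_of g) \<subseteq> carrier G"
    using assms by (intro keys_minusI) auto
  then show ?case using one by (simp add: aug_mult_frag_of)
qed (simp_all add: aug_mult_simps keys_minusI)

lemma keys_aug_prod: "graded H ps \<Longrightarrow> Poly_Mapping.keys (aug_prod G ps) \<subseteq> carrier G"
  by (induction ps) (auto simp: one_group_ring keys_aug_mult H_carrier dest!: subsetD[OF keys_aug_mult, rotated 2])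

lemma filt_subset_keys: "u \<in> filt G H m \<Longrightarrow> Poly_Mapping.keys u \<subseteq> carrier G"
  unfolding filt_eq
proof (induction rule: generate.induct)
  case (inv h)
  then have "Poly_Mapping.keys h \<subseteq> carrier G" by (auto dest: keys_aug_prod)
  then show ?case by simp
next
  case (eng h1 h2)
  then show ?case by (simp add: keys_plusI)
qed (auto dest: keys_aug_prod)

lemma filt_subgroup: "subgroup (filt G H m) (free_Abelian_group (carrier G))"
  unfolding filt_eq
  by (rule group.generate_is_subgroup[OF group_free_Abelian_group]) (auto dest: keys_aug_prod)

lemma filt_diff: assumes "u \<in> filt G H m" "v \<in> filt G H m" shows "u - v \<in> filt G H m"
proof -
  have "inv\<^bsub>free_Abelian_group (carrier G)\<^esub> v \<in> filt G H m"
    using filt_subgroup assms(2) by (rule subgroup.m_inv_closed)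
  then have "- v \<in> filt G H m" using filt_subset_keys[OF assms(2)] by simp
  from filt_add[OF assms(1) this] show ?thesis by simp
qed

lemma filt_minus: assumes "v \<in> filt G H m" shows "- v \<in> filt G H m"
  using filt_diff[OF filt_zero assms] by simp

text \<open>Inverses and sums are differences starting from 0, so one closure case replaces two of
  \<open>generate\<close>, in the same shape as \<open>frag_induction\<close>.\<close>

lemma filt_induct [consumes 1, case_names zero prod diff]:
  assumes u: "u \<in> filt G H m" and P: "P 0"
    "\<And>ps. graded H ps \<Longrightarrow> m \<le> weight ps \<Longrightarrow> P (aug_prod G ps)" "\<And>a b. P a \<Longrightarrow> P b \<Longrightarrow> P (a - b)"
  shows "P u"
  using u unfolding filt_eq
proof (induction rule: generate.induct)
  case (inv h)
  then have "P h" by (auto intro: P)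
  then have "P (0 - h)" by (intro P(1,3))
  moreover have "Poly_Mapping.keys h \<subseteq> carrier G" using inv by (auto dest: keys_aug_prod)
  ultimately show ?case by simp
next
  case (eng h1 h2)
  then have "P (h1 - (0 - h2))" by (intro P)
  then show ?case by simp
qed (auto intro: P)

lemma filt_anti: assumes "k \<le> m" "u \<in> filt G H m" shows "u \<in> filt G H k"
  using assms(2) by (induction rule: filt_induct) (use assms(1) aug_prod_in_filt filt_diff in force)+

lemma aug_mult_filt:
  assumes "1 \<le> a" "x \<in> H a" "p \<in> filt G H m"
  shows "aug_mult G x p \<in> filt G H (a + m)"
  using assms(3)
proof (induction rule: filt_induct)
  case (prod ps)
  then have "aug_prod G ((x, a) # ps) \<in> filt G H (a + m)"
    using assms by (intro aug_prod_in_filt) auto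
  then show ?case by simp
qed (auto simp: aug_mult_simps filt_diff)

lemma aug_filt:
  assumes "1 \<le> a" "x \<in> H a" shows "aug G x \<in> filt G H a"
proof -
  have "aug_prod G [(x, a)] \<in> filt G H a" using assms by (intro aug_prod_in_filt) auto
  then show ?thesis using assms H_carrier by (simp add: aug_mult_one one_group_ring)
qed

lemma aug_filt_1: "x \<in> carrier G \<Longrightarrow> aug G x \<in> filt G H 1"
  by (rule aug_filt) (simp_all add: H_1)

text \<open>The empty product has weight 0, so A_0 contains 1, and g = (g - 1) + 1. The extra level
  A_0 is where the closure conditions of the search begin.\<close>

lemma filt_0: assumes "Poly_Mapping.keys p \<subseteq> carrier G" shows "p \<in> filt G H 0"
  using assms
proof (induction p rule: frag_induction)
  case (one g)
  have "frag_of \<one> \<in> filt G H 0"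
    using aug_prod_in_filt[of H "[]" 0 G] by (simp add: one_group_ring)
  moreover have "aug G g \<in> filt G H 0" using one by (intro filt_anti[OF _ aug_filt_1]) auto
  ultimately have "aug G g + frag_of \<one> \<in> filt G H 0" by (intro filt_add) auto
  then show ?case by (simp add: aug_def)
qed (auto intro: filt_diff)

text \<open>The difference is (x - 1)(y - 1), of weight 2n \<ge> n + 1. This is additivity of
  \<open>phi\<close>.\<close>

lemma aug_mult_cong:
  assumes n: "1 \<le> n" and x: "x \<in> H n" "y \<in> H n"
  shows "aug G (x \<otimes> y) - aug G x - aug G y \<in> filt G H (Suc n)"
proof -
  have "aug_mult G x (aug G y) \<in> filt G H (n + n)"
    using n x by (intro aug_mult_filt aug_filt)
  then have "aug_mult G x (aug G y) \<in> filt G H (Suc n)"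
    using n by (intro filt_anti[of "Suc n" "n + n"]) auto
  then show ?thesis using x n H_carrier by (simp add: aug_mult_aug)
qed

lemma aug_div_cong:
  assumes n: "1 \<le> n" and x: "x \<in> H n" "y \<in> H n"
  shows "aug G (x \<otimes> inv y) - (aug G x - aug G y) \<in> filt G H (Suc n)"
proof -
  have c: "x \<in> carrier G" "y \<in> carrier G" using n x H_carrier by auto
  have "x \<otimes> inv y \<in> H n" using n x H_subgroup by (meson subgroup.m_closed subgroup.m_inv_closed)
  from aug_mult_cong[OF n this x(2)] c
  have "aug G x - aug G (x \<otimes> inv y) - aug G y \<in> filt G H (Suc n)" by (simp add: m_assoc)
  from filt_minus[OF this] show ?thesis by (simp add: algebra_simps)
qed

lemma aug_inv_cong:
  assumes n: "1 \<le> n" and y: "y \<in> H n"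
  shows "aug G (inv y) + aug G y \<in> filt G H (Suc n)"
  using aug_div_cong[OF n subgroup.one_closed[OF H_subgroup[OF n]] y] H_carrier[OF n y] by simp

section \<open>Cosets of the series\<close>

lemma E_grp_simps: "carrier (E_grp G H n) = rcosets (H (Suc n))" "\<one>\<^bsub>E_grp G H n\<^esub> = H (Suc n)"
   "X \<otimes>\<^bsub>E_grp G H n\<^esub> Y = X <#> Y"
  by (simp_all add: E_grp_def FactGroup_def)

lemma Q_grp_simps: "carrier (Q_grp G H n) = rcosets (H n)" "\<one>\<^bsub>Q_grp G H n\<^esub> = H n"
   "X \<otimes>\<^bsub>Q_grp G H n\<^esub> Y = X <#> Y"
  by (simp_all add: Q_grp_def FactGroup_def)

lemma coset_mult: "1 \<le> a \<Longrightarrow> x \<in> carrier G \<Longrightarrow> y \<in> carrier G \<Longrightarrow> (H a #> x) <#> (H a #> y) = H a #> (x \<otimes> y)"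
  using H_normal normal.rcos_sum by metis

lemma coset_eq_iff:
  assumes "1 \<le> a" "x \<in> carrier G" "y \<in> carrier G"
  shows "H a #> x = H a #> y \<longleftrightarrow> x \<otimes> inv y \<in> H a"
proof -
  have "H a #> x = H a #> y \<longleftrightarrow> x \<in> H a #> y"
    using assms H_subgroup rcos_self repr_independence by metis
  also have "\<dots> \<longleftrightarrow> x \<otimes> inv y \<in> H a"
    using assms H_subgroup is_group by (simp add: subgroup.rcos_module)
  finally show ?thesis .
qed

lemma coset_eq_self_iff:
  assumes "1 \<le> a" "x \<in> carrier G"
  shows "H a #> x = H a \<longleftrightarrow> x \<in> H a"
  using assms H_subgroup coset_join1 coset_join2 by metis

lemma rcosets_eq: "rcosets (H a) = (\<lambda>x. H a #> x) ` carrier G"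
  by (auto simp: RCOSETS_def)

lemma proj_coset:
  assumes "1 \<le> n" "x \<in> carrier G"
  shows "proj G H n (H (Suc n) #> x) = H n #> x"
proof -
  have c: "H n \<subseteq> carrier G" "H (Suc n) \<subseteq> carrier G" "H (Suc n) \<subseteq> H n"
    using assms H_carrier H_Suc by auto
  have "H n <#> H (Suc n) = H n"
  proof
    show "H n <#> H (Suc n) \<subseteq> H n"
      using assms c H_subgroup[of n] by (auto simp: set_mult_def subgroup.m_closed subset_iff)
    have "x \<otimes> \<one> \<in> H n <#> H (Suc n)" if "x \<in> H n" for x
      unfolding set_mult_def using that H_subgroup[of "Suc n"] subgroup.one_closed by fastforce
    then show "H n \<subseteq> H n <#> H (Suc n)" using c by (metis r_one subsetD subsetI)
  qed
  then show ?thesis using assms c by (simp add: proj_def setmult_rcos_assoc)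
qed

end

section \<open>The central extension at step n and the cokernel\<close>

locale N_series_section = N_series_group +
  fixes n :: nat and s :: "'a set \<Rightarrow> 'a set"
  assumes n: "1 \<le> n" and section_s: "normalized_section G H n s"
begin

abbreviation "E \<equiv> E_grp G H n"
abbreviation "Q \<equiv> Q_grp G H n"
abbreviation "\<pi> \<equiv> proj G H n"
abbreviation "cl x \<equiv> H (Suc n) #> x"

lemma n' [simp]: "Suc 0 \<le> n" "0 < n" "1 \<le> n" using n by auto

lemma central_ext: "central_ext E Q \<pi> s"
proof (rule central_ext.intro)
  show "group E" "group Q"
    unfolding E_grp_def Q_grp_def using H_normal by (auto intro!: normal.factorgroup_is_group)
  show "\<pi> \<in> hom E Q"
    by (auto simp: hom_def E_grp_simps Q_grp_simps rcosets_eq proj_coset coset_mult)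
  show "c \<otimes>\<^bsub>E\<^esub> x = x \<otimes>\<^bsub>E\<^esub> c" if c: "c \<in> carrier E" "\<pi> c = \<one>\<^bsub>Q\<^esub>" and x: "x \<in> carrier E" for c x
  proof -
    obtain h g where h: "h \<in> carrier G" "c = cl h" and g: "g \<in> carrier G" "x = cl g"
      using c x by (auto simp: E_grp_simps rcosets_eq)
    have "h \<in> H n" using c h by (simp add: Q_grp_simps proj_coset coset_eq_self_iff)
    \<comment> \<open>The commutator condition for the indices n and 1, with \<open>H 1\<close> the
      whole group.\<close>
    then have "h \<otimes> g \<otimes> inv h \<otimes> inv g \<in> H (n + 1)"
      using g by (intro H_commutator) (auto simp: H_1)
    moreover have "(h \<otimes> g) \<otimes> inv (g \<otimes> h) = h \<otimes> g \<otimes> inv h \<otimes> inv g"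
      using g h by (simp add: inv_mult_group m_assoc)
    ultimately have "cl (h \<otimes> g) = cl (g \<otimes> h)"
      using g h by (simp add: coset_eq_iff)
    then show ?thesis using g h by (simp add: E_grp_simps coset_mult)
  qed
qed (use section_s in \<open>auto simp: normalized_section_def\<close>)

sublocale central_ext E Q \<pi> s by (rule central_ext)

lemma cl_carrier [simp]: "g \<in> carrier G \<Longrightarrow> cl g \<in> carrier E"
  by (auto simp: E_grp_simps rcosets_eq)

lemma K_eq: "K = cl ` H n"
proof -
  have "\<pi> (cl x) = H n \<longleftrightarrow> x \<in> H n" if "x \<in> carrier G" for x
    using that by (simp add: proj_coset coset_eq_self_iff)
  then show ?thesis
    using H_carrier[OF n] unfolding K_def E_grp_simps Q_grp_simps rcosets_eq by blast
qed

lemma K_mem: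
  assumes "X \<in> K" "t \<in> X" shows "t \<in> H n" "X = cl t"
proof -
  obtain h where h: "h \<in> H n" "X = cl h" using assms by (auto simp: K_eq)
  then have hc: "h \<in> carrier G" using H_carrier n by blast
  have "t \<in> carrier G" using assms h hc H_subgroup[of "Suc n"]
    by (metis is_group le_SucI n subgroup.elemrcos_carrier)
  show "X = cl t" unfolding h(2) using h hc assms H_subgroup[of "Suc n"] by (intro repr_independence) auto
  have "t \<otimes> inv h \<in> H (Suc n)"
    using assms h hc \<open>t \<in> carrier G\<close> H_subgroup[of "Suc n"] is_group by (simp add: subgroup.rcos_module)
  then have "t \<otimes> inv h \<otimes> h \<in> H n"
    using H_Suc[of n] h H_subgroup[of n] by (auto simp: subgroup.m_closed)
  then show "t \<in> H n" using \<open>t \<in> carrier G\<close> hc by (simp add: m_assoc)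
qed

lemma K_nonempty: "X \<in> K \<Longrightarrow> \<exists>t. t \<in> X"
  using H_subgroup[of "Suc n"] H_carrier[of n] by (auto simp: K_eq intro!: rcos_self)

lemma cl_one_iff: "h \<in> carrier G \<Longrightarrow> cl h = \<one>\<^bsub>E\<^esub> \<longleftrightarrow> h \<in> H (Suc n)"
  by (simp add: E_grp_simps coset_eq_self_iff)

lemma cl_inv: "h \<in> carrier G \<Longrightarrow> inv\<^bsub>E\<^esub> (cl h) = cl (inv h)"
  by (rule E.inv_equality) (auto simp: E_grp_simps coset_mult coset_eq_self_iff rcosets_eq H_subgroup subgroup.one_closed)

lemma cl_mult: "h \<in> carrier G \<Longrightarrow> g \<in> carrier G \<Longrightarrow> cl h \<otimes>\<^bsub>E\<^esub> cl g = cl (h \<otimes> g)"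
  by (simp add: E_grp_simps coset_mult)

text \<open>The lift of \<open>vartheta\<close> to the group ring before passing to cosets, so that
  congruences can be added and subtracted as elements of A_{n+1}.\<close>

definition vt where
  "vt = frag_extend (\<lambda>qs. aug G (alpha_rep G H n s (qs ! 0) (qs ! 1)))"

lemma aug_coset_cong:
  assumes "t \<in> H n" "t' \<in> H n" "cl t = cl t'"
  shows "aug G t - aug G t' \<in> filt G H (Suc n)"
proof -
  have "t \<otimes> inv t' \<in> H (Suc n)" using assms H_carrier n' coset_eq_iff
    by (metis le_SucI n)
  then have "aug G (t \<otimes> inv t') - (aug G (t \<otimes> inv t') - (aug G t - aug G t')) \<in> filt G H (Suc n)"
    using assms by (intro filt_diff aug_div_cong aug_filt) auto
  then show ?thesis by simp
qed

text \<open>The factorization of \<open>vartheta\<close> through \<open>phi\<close>, on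
  representatives. It holds for every t in the coset \<open>theta z\<close>, so the induction may
  choose its own representatives of \<open>theta a\<close> and \<open>theta b\<close>.\<close>

lemma vt_theta:
  assumes "Poly_Mapping.keys z \<subseteq> bar_basis Q 2" "t \<in> theta z"
  shows "vt z - aug G t \<in> filt G H (Suc n)"
proof -
  have "Poly_Mapping.keys z \<subseteq> bar_basis Q 2 \<and> (\<forall>t\<in>theta z. vt z - aug G t \<in> filt G H (Suc n))"
    using assms(1)
  proof (induction z rule: frag_induction)
    case zero
    have "aug G t \<in> filt G H (Suc n)" if "t \<in> H (Suc n)" for t
      using that by (intro aug_filt) auto
    then show ?case by (auto simp: vt_def E_grp_simps intro: filt_minus)
  next
    case (one qs)
    then obtain x y where es: "qs = [x, y]" and xy: "x \<in> carrier Q" "y \<in> carrier Q"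
      by (auto elim: bar_basis_2E)
    have th: "theta (frag_of qs) = al x y" using theta(2)[OF one] by (simp add: es)
    have K: "al x y \<in> K" using xy by simp
    have "alpha_rep G H n s x y \<in> al x y"
      unfolding alpha_rep_def using someI_ex[OF K_nonempty[OF K]] by (simp add: alpha_def al_def)
    then have "aug G (alpha_rep G H n s x y) - aug G t \<in> filt G H (Suc n)" if "t \<in> al x y" for t
      using K_mem[OF K] that by (intro aug_coset_cong) auto
    then show ?case using one th by (simp add: vt_def es)
  next
    case (diff a b)
    have K: "theta a \<in> K" "theta b \<in> K" using diff by (simp_all add: theta_closed)
    obtain u v where uv: "u \<in> theta a" "v \<in> theta b" using K K_nonempty by blast
    have uvH: "u \<in> H n" "v \<in> H n" and cl: "theta a = cl u" "theta b = cl v" using uv K K_mem by auto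
    have c: "u \<in> carrier G" "v \<in> carrier G" using uvH H_carrier[OF n] by auto
    have th: "theta (a - b) = cl (u \<otimes> inv v)"
      using diff cl c by (simp add: theta_diff cl_inv cl_mult)
    have "vt (a - b) - aug G t \<in> filt G H (Suc n)" if t: "t \<in> theta (a - b)" for t
    proof -
      have tH: "t \<in> H n" "theta (a - b) = cl t" using K_mem[OF _ t] diff by (auto simp: theta_closed keys_minusI)
      have "u \<otimes> inv v \<in> H n" using uvH H_subgroup[of n] by (simp add: subgroup.m_closed subgroup.m_inv_closed)
      then have "aug G (u \<otimes> inv v) - aug G t \<in> filt G H (Suc n)"
        using tH th by (intro aug_coset_cong) auto
      moreover have "vt a - aug G u \<in> filt G H (Suc n)" "vt b - aug G v \<in> filt G H (Suc n)"
        using diff uv by auto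
      \<comment> \<open>The terms in u and v cancel; what remains is
        \<open>vt a - vt b - aug G t\<close>.\<close>
      ultimately have "(vt a - aug G u) - (vt b - aug G v) - (aug G (u \<otimes> inv v) - (aug G u - aug G v))
          + (aug G (u \<otimes> inv v) - aug G t) \<in> filt G H (Suc n)"
        by (intro filt_add[OF filt_diff[OF filt_diff aug_div_cong[OF n uvH]]])
      moreover have "vt (a - b) = vt a - vt b" by (simp add: vt_def frag_extend_diff)
      ultimately show ?thesis by simp
    qed
    then show ?case using diff by (simp add: keys_minusI)
  qed
  then show ?thesis using assms(2) by blast
qed

text \<open>Modulo \<open>B1 E\<close>, the map induced by \<open>g \<mapsto> [g H\<^sub>n\<^sub>+\<^sub>1]\<close> kills all products of two augmentation
  elements, so that only \<open>H\<^sub>n\<^sub>+\<^sub>1\<close> contributes from \<open>A\<^sub>n\<^sub>+\<^sub>1\<close>.\<close>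

definition bar1 :: "('a \<Rightarrow>\<^sub>0 int) \<Rightarrow> ('a set list \<Rightarrow>\<^sub>0 int)" where
  "bar1 = frag_extend (\<lambda>g. bar_sym E [cl g])"

lemma bar1_simps: "bar1 (a - b) = bar1 a - bar1 b" "bar1 (frag_of g) = bar_sym E [cl g]" "bar1 0 = 0"
  by (simp_all add: bar1_def frag_extend_diff)

lemma bar1_aug: "bar1 (aug G h) = bar_sym E [cl h]"
proof -
  have "cl \<one> = \<one>\<^bsub>E\<^esub>" by (simp add: cl_one_iff H_subgroup subgroup.one_closed)
  then show ?thesis by (simp add: aug_def bar1_simps)
qed

text \<open>The four terms of (x - 1)(y - 1)g, with [x] added and subtracted, regroup into two
  relations of the form [uv] - [u] - [v]. The factor p absorbs the remaining factors of a longer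
  product.\<close>

lemma bar1_products:
  assumes xy: "x \<in> carrier G" "y \<in> carrier G" and p: "Poly_Mapping.keys p \<subseteq> carrier G"
  shows "bar1 (aug_mult G x (aug_mult G y p)) \<in> B1 E"
  using p
proof (induction p rule: frag_induction)
  case (one g)
  let ?b = "\<lambda>g. bar_sym E [cl g]"
  have *: "?b (u \<otimes> v) - ?b u - ?b v \<in> B1 E" if "u \<in> carrier G" "v \<in> carrier G" for u v
    using B1_sym[OF group_E, of "cl u" "cl v"] that by (simp add: cl_mult)
  have "(?b (x \<otimes> (y \<otimes> g)) - ?b x - ?b (y \<otimes> g)) - (?b (x \<otimes> g) - ?b x - ?b g) \<in> B1 E"
    using xy one by (intro B1_diff *) auto
  moreover have "bar1 (aug_mult G x (aug_mult G y (frag_of g))) =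
      (?b (x \<otimes> (y \<otimes> g)) - ?b x - ?b (y \<otimes> g)) - (?b (x \<otimes> g) - ?b x - ?b g)"
    using xy one by (simp add: aug_mult_frag_of aug_mult_simps bar1_simps)
  ultimately show ?case by simp
qed (auto simp: aug_mult_simps bar1_simps B1_zero B1_diff)

lemma bar1_filt: "u \<in> filt G H (Suc n) \<Longrightarrow> bar1 u \<in> B1 E"
proof (induction rule: filt_induct)
  case (prod ps)
  \<comment> \<open>The weight excludes the empty product, forces a single factor into H_{n+1},
    where its symbol is degenerate, and leaves the longer products to
    \<open>bar1_products\<close>.\<close>
  consider "ps = []" | x a where "ps = [(x, a)]" | x a y b qs where "ps = (x, a) # (y, b) # qs"
    by (cases ps; cases "tl ps") auto
  then show ?case
  proof cases
    case 2
    then have a: "Suc n \<le> a" "x \<in> H a" using prod by auto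
    then have "x \<in> H (Suc n)" using H_anti[of "Suc n" a] by auto
    then have "bar_sym E [cl x] = 0" and "x \<in> carrier G"
      using cl_one_iff[of x] H_carrier[of "Suc n" x] by auto
    then show ?thesis using 2 by (simp add: aug_mult_one one_group_ring bar1_aug B1_zero)
  next
    case 3
    then have "x \<in> carrier G" "y \<in> carrier G" "graded H qs" using prod H_carrier by auto
    then show ?thesis using bar1_products[of x y "aug_prod G qs"] keys_aug_prod[of qs] 3 by simp
  qed (use prod in auto)
qed (auto simp: bar1_simps B1_zero B1_diff)

lemma vartheta_eq: "vartheta G H n s z = filt G H (Suc n) #>\<^bsub>free_Abelian_group (carrier G)\<^esub> vt z"
  unfolding vartheta_def filt_class_def vt_def add_monoid_group_ring by (rule refl)

lemma keys_vt:
  assumes "Poly_Mapping.keys z \<subseteq> bar_basis Q 2" shows "Poly_Mapping.keys (vt z) \<subseteq> carrier G"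
proof -
  obtain t where t: "t \<in> theta z" using K_nonempty[OF theta_closed[OF assms]] by blast
  then have "t \<in> carrier G" using K_mem[OF theta_closed[OF assms]] H_carrier n by blast
  then have "Poly_Mapping.keys ((vt z - aug G t) + aug G t) \<subseteq> carrier G"
    using filt_subset_keys[OF vt_theta[OF assms t]] keys_aug by (intro keys_plusI)
  then show ?thesis by simp
qed

lemma carrier_D_bar: "carrier (D_bar G H n s) = {z \<in> Z2 Q. vt z \<in> filt G H (Suc n)}"
proof -
  let ?F = "free_Abelian_group (carrier G)"
  have "filt G H (Suc n) #>\<^bsub>?F\<^esub> vt z = filt G H (Suc n) \<longleftrightarrow> vt z \<in> filt G H (Suc n)" if "z \<in> Z2 Q" for z
    using that keys_vt[of z] filt_subgroup[of "Suc n"] group.coset_join1[OF group_free_Abelian_group]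
      group.coset_join2[OF group_free_Abelian_group] carrier_free_Abelian_group_iff Z2_iff by metis
  then show ?thesis
    by (auto simp: D_bar_def kernel_def vartheta_eq filt_quot_def FactGroup_def)
qed

text \<open>The description of the image does not involve the filtration: A_{n+1} enters the
  cokernel only through the target D.\<close>

lemma image_R_bar: "R_bar G H n ` carrier (L_bar G H n s) = {z \<in> Z2 Q. theta z = \<one>\<^bsub>E\<^esub>}"
proof (intro equalityI subsetI)
  fix z assume "z \<in> R_bar G H n ` carrier (L_bar G H n s)"
  then obtain w c where w: "w \<in> Z2 E" and c: "Poly_Mapping.keys c \<subseteq> bar_basis Q 3"
    and z: "z = bar_map Q \<pi> w + bar_bd Q c" and "z \<in> Z2 Q"
    by (auto simp: L_bar_def R_bar_def carrier_D_bar)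
  have "theta z = \<one>\<^bsub>E\<^esub>"
    using w c by (simp add: z Z2_iff theta_add keys_bar_map keys_bar_bd_3 group_Q theta_bar_map theta_bd_3)
  with \<open>z \<in> Z2 Q\<close> show "z \<in> {z \<in> Z2 Q. theta z = \<one>\<^bsub>E\<^esub>}" by simp
next
  fix z assume "z \<in> {z \<in> Z2 Q. theta z = \<one>\<^bsub>E\<^esub>}"
  then have z: "z \<in> Z2 Q" "theta z = \<one>\<^bsub>E\<^esub>" by auto
  obtain w where w: "w \<in> Z2 E" "bar_map Q \<pi> w = z" using theta_exact[OF z] .
  \<comment> \<open>The coset \<open>theta z\<close> is H_{n+1}, so \<one> represents it; since
    \<open>aug G \<one> = 0\<close>, \<open>vt_theta\<close> then puts \<open>vt z\<close> itself
    into A_{n+1}.\<close>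
  have "\<one> \<in> theta z" using z H_subgroup[of "Suc n"] by (simp add: E_grp_simps subgroup.one_closed)
  then have "vt z \<in> filt G H (Suc n)" using vt_theta[of z \<one>] z by (simp add: Z2_iff)
  then have "(w, 0) \<in> carrier (L_bar G H n s)" using w z
    by (simp add: L_bar_def R_bar_def carrier_D_bar)
  moreover have "R_bar G H n (w, 0) = z" using w by (simp add: R_bar_def)
  ultimately show "z \<in> R_bar G H n ` carrier (L_bar G H n s)" by force
qed

lemma trivial_coker_iff_subset:
  "trivial_group (coker_R_bar G H n s) \<longleftrightarrow> carrier (D_bar G H n s) \<subseteq> {z \<in> Z2 Q. theta z = \<one>\<^bsub>E\<^esub>}"
  (is "_ \<longleftrightarrow> ?D \<subseteq> ?I")
proof -
  let ?B = "bar_chains Q 2"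
  have ID: "?I \<subseteq> ?D"
  proof
    fix z assume z: "z \<in> ?I"
    have "\<one> \<in> theta z" using z H_subgroup[of "Suc n"] by (simp add: E_grp_simps subgroup.one_closed)
    then show "z \<in> ?D" using vt_theta[of z \<one>] z by (simp add: Z2_iff carrier_D_bar)
  qed
  have sub: "subgroup ?D ?B"
  proof (rule group.subgroupI[OF group_bar_chains])
    show "?D \<subseteq> carrier ?B" by (auto simp: carrier_D_bar Z2_iff)
    have "0 \<in> ?D" by (simp add: carrier_D_bar Z2_iff vt_def)
    then show "?D \<noteq> {}" by blast
    fix a assume a: "a \<in> ?D"
    have "bar_bd Q (- a) = - bar_bd Q a" "vt (- a) = - vt a"
      by (simp_all add: bar_bd_def vt_def frag_extend_minus)
    then show "inv\<^bsub>?B\<^esub> a \<in> ?D"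
      using a by (simp add: carrier_D_bar Z2_iff bar_chains_inv filt_minus)
    fix b assume b: "b \<in> ?D"
    show "a \<otimes>\<^bsub>?B\<^esub> b \<in> ?D" using a b
      by (simp add: carrier_D_bar Z2_iff keys_plusI bar_bd_add) (simp add: vt_def frag_extend_add filt_add)
  qed
  \<comment> \<open>A name for the carrier keeps \<open>D_eq\<close> from having
    \<open>D_bar\<close> on both sides, where rewriting would not stop.\<close>
  define DD where "DD = ?D"
  have D_eq: "D_bar G H n s = ?B\<lparr>carrier := DD\<rparr>"
    by (simp add: D_bar_def DD_def)
  have comm: "comm_group (D_bar G H n s)"
    unfolding D_eq by (rule group.group_comm_groupI[OF group.subgroup_imp_group[OF group_bar_chains sub[folded DD_def]]]) simp
  interpret D: comm_group "D_bar G H n s" by (rule comm)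
  have mult: "x \<otimes>\<^bsub>D_bar G H n s\<^esub> y = x + y" for x y by (subst D_eq) simp
  have coker: "coker_R_bar G H n s = D_bar G H n s Mod ?I"
    by (simp add: coker_R_bar_def coker_def image_R_bar)
  show ?thesis
  proof
    assume "trivial_group (coker_R_bar G H n s)"
    then have c: "rcosets\<^bsub>D_bar G H n s\<^esub> ?I = {?I}" by (simp add: coker trivial_group_def FactGroup_def)
    show "?D \<subseteq> ?I"
    proof
      fix a assume "a \<in> ?D"
      then have "?I #>\<^bsub>D_bar G H n s\<^esub> a = ?I" using c by (auto simp: RCOSETS_def)
      moreover have "0 \<otimes>\<^bsub>D_bar G H n s\<^esub> a \<in> ?I #>\<^bsub>D_bar G H n s\<^esub> a"
        unfolding r_coset_def by (auto simp: Z2_iff)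
      ultimately show "a \<in> ?I" by (simp only: mult add_0)
    qed
  next
    assume "?D \<subseteq> ?I"
    then have I: "?I = ?D" using ID by blast
    have S: "subgroup ?D (D_bar G H n s)" by (rule D.subgroup_self)
    have "?D \<lhd> D_bar G H n s" using S by (simp add: D.normal_iff_subgroup)
    then have "group (D_bar G H n s Mod ?D)" by (rule normal.factorgroup_is_group)
    moreover have "rcosets\<^bsub>D_bar G H n s\<^esub> ?D = {?D}"
      using S D.coset_join2[OF _ S] D.one_closed by (auto simp: RCOSETS_def)
    ultimately show "trivial_group (coker_R_bar G H n s)"
      by (simp add: coker trivial_group_def I FactGroup_def)
  qed
qed

text \<open>From left to right, h - 1 in A_{n+1} makes [h] a boundary in \<open>E\<close>, so
  \<open>theta_surj\<close> produces a cycle z with value the inverse class of h. This z lies in D,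
  and triviality of the cokernel forces its value to be 1.\<close>

lemma trivial_coker_iff:
  "trivial_group (coker_R_bar G H n s) \<longleftrightarrow> (\<forall>h\<in>H n. aug G h \<in> filt G H (Suc n) \<longrightarrow> h \<in> H (Suc n))"
  unfolding trivial_coker_iff_subset carrier_D_bar
proof (intro iffI ballI impI subsetI)
  fix h assume sub: "{z \<in> Z2 Q. vt z \<in> filt G H (Suc n)} \<subseteq> {z \<in> Z2 Q. theta z = \<one>\<^bsub>E\<^esub>}"
    and h: "h \<in> H n" and a: "aug G h \<in> filt G H (Suc n)"
  have hc: "h \<in> carrier G" using h H_carrier n by blast
  have "bar_sym E [cl h] \<in> B1 E" using bar1_filt[OF a] by (simp add: bar1_aug)
  then obtain z where z: "z \<in> Z2 Q" "theta z = inv\<^bsub>E\<^esub> (cl h)"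
    using theta_surj[of "cl h"] h by (auto simp: K_eq)
  have "inv h \<in> theta z" using z hc H_subgroup[of "Suc n"] by (simp add: cl_inv rcos_self)
  then have "vt z - aug G (inv h) \<in> filt G H (Suc n)" using z vt_theta by (simp add: Z2_iff)
  \<comment> \<open>The sum equals \<open>vt z\<close>; the middle term turns the inverse from
    \<open>theta_surj\<close> into a sign.\<close>
  then have "(vt z - aug G (inv h)) + (aug G (inv h) + aug G h) - aug G h \<in> filt G H (Suc n)"
    using h by (intro filt_diff[OF filt_add[OF _ aug_inv_cong] a]) auto
  then have "inv\<^bsub>E\<^esub> (cl h) = \<one>\<^bsub>E\<^esub>" using sub z by auto
  then have "cl h = \<one>\<^bsub>E\<^esub>" using hc cl_carrier E.inv_eq_1_iff by blast
  then show "h \<in> H (Suc n)" using hc by (simp add: cl_one_iff)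
next
  fix z assume inj: "\<forall>h\<in>H n. aug G h \<in> filt G H (Suc n) \<longrightarrow> h \<in> H (Suc n)"
    and z: "z \<in> {z \<in> Z2 Q. vt z \<in> filt G H (Suc n)}"
  have k: "Poly_Mapping.keys z \<subseteq> bar_basis Q 2" using z by (simp add: Z2_iff)
  obtain h where h: "h \<in> theta z" using K_nonempty theta_closed[OF k] by blast
  then have hn: "h \<in> H n" "theta z = cl h" using K_mem theta_closed[OF k] by auto
  have "vt z - (vt z - aug G h) \<in> filt G H (Suc n)"
    using z by (intro filt_diff[OF _ vt_theta[OF k h]]) auto
  then have "h \<in> H (Suc n)" using inj hn by simp
  then show "z \<in> {z \<in> Z2 Q. theta z = \<one>\<^bsub>E\<^esub>}" using z hn by (simp add: cl_one_iff H_carrier[OF n])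
qed

end

section \<open>Injectivity of \<open>phi\<close> as a condition on single elements\<close>

context N_series_group
begin

text \<open>Both the well-definedness behind \<open>the_elem\<close> and the reduction from pairs to
  kernel elements come from \<open>class_eq\<close>, that is, from additivity modulo
  A_{n+1}.\<close>

lemma inj_phi_iff:
  assumes n: "1 \<le> n"
  shows "inj_on (phi G H n) (carrier (C_grp G H n)) \<longleftrightarrow>
    (\<forall>h\<in>H n. aug G h \<in> filt G H (Suc n) \<longrightarrow> h \<in> H (Suc n))"
proof -
  let ?F = "free_Abelian_group (carrier G)" and ?cl = "\<lambda>x. H (Suc n) #> x"
  have C: "carrier (C_grp G H n) = ?cl ` H n"
    by (auto simp: C_grp_def FactGroup_def RCOSETS_def r_coset_def)
  have sub: "subgroup (H n) G" "subgroup (H (Suc n)) G" using H_subgroup n by auto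
  have class_eq: "filt_class G H n (aug G x) = filt_class G H n (aug G y) \<longleftrightarrow>
     aug G (x \<otimes> inv y) \<in> filt G H (Suc n)" if xy: "x \<in> H n" "y \<in> H n" for x y
  proof -
    have k: "Poly_Mapping.keys (aug G x) \<subseteq> carrier G" "Poly_Mapping.keys (aug G y) \<subseteq> carrier G"
      using xy keys_aug H_carrier n by auto
    have "filt_class G H n (aug G x) = filt_class G H n (aug G y) \<longleftrightarrow>
       aug G x \<in> filt G H (Suc n) #>\<^bsub>?F\<^esub> aug G y"
      unfolding filt_class_def add_monoid_group_ring
      using group.rcos_self[OF group_free_Abelian_group _ filt_subgroup] k
        group.repr_independence[OF group_free_Abelian_group _ _ filt_subgroup]
      by (metis carrier_free_Abelian_group_iff)
    also have "\<dots> \<longleftrightarrow> aug G x - aug G y \<in> filt G H (Suc n)"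
      using subgroup.rcos_module[OF filt_subgroup group_free_Abelian_group, of "aug G y" "aug G x"] k by simp
    also have "\<dots> \<longleftrightarrow> aug G (x \<otimes> inv y) \<in> filt G H (Suc n)"
      using filt_add[OF aug_div_cong[OF n xy], of "aug G x - aug G y"]
         filt_diff[OF _ aug_div_cong[OF n xy], of "aug G (x \<otimes> inv y)"] by auto
    finally show ?thesis .
  qed
  have div: "x \<otimes> inv y \<in> H n" if "x \<in> H n" "y \<in> H n" for x y
    using sub that by (simp add: subgroup.m_closed subgroup.m_inv_closed)
  have phi: "phi G H n (?cl x) = filt_class G H n (aug G x)" if x: "x \<in> H n" for x
  proof -
    have xc: "x \<in> carrier G" using x H_carrier n by auto
    have "filt_class G H n (aug G t) = filt_class G H n (aug G x)" if t: "t \<in> ?cl x" for t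
    proof -
      have tx: "t \<otimes> inv x \<in> H (Suc n)"
        using t xc sub is_group by (simp add: subgroup.rcos_module_imp)
      have "t \<in> carrier G" using t xc sub is_group by (meson subgroup.elemrcos_carrier)
      moreover have "t \<otimes> inv x \<otimes> x \<in> H n"
        using tx H_Suc[OF n] x sub by (auto simp: subgroup.m_closed)
      ultimately have "t \<in> H n" using xc by (simp add: m_assoc)
      then show ?thesis using class_eq x tx aug_filt by simp
    qed
    then have "(\<lambda>h. filt_class G H n (aug G h)) ` ?cl x = (\<lambda>_. filt_class G H n (aug G x)) ` ?cl x"
      by (rule image_cong[OF refl])
    also have "\<dots> = {filt_class G H n (aug G x)}"
      by (rule image_constant[OF rcos_self[OF xc sub(2)]])
    finally have "(\<lambda>h. filt_class G H n (aug G h)) ` ?cl x = {filt_class G H n (aug G x)}" .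
    then show ?thesis by (simp add: phi_def)
  qed
  have cl_eq: "?cl x = ?cl y \<longleftrightarrow> x \<otimes> inv y \<in> H (Suc n)" if "x \<in> H n" "y \<in> H n" for x y
    using that H_carrier[OF n] by (simp add: coset_eq_iff)
  have one: "\<one> \<in> H n" using sub by (simp add: subgroup.one_closed)
  show ?thesis
  proof (intro iffI ballI impI)
    fix h assume inj: "inj_on (phi G H n) (carrier (C_grp G H n))" and h: "h \<in> H n"
      and a: "aug G h \<in> filt G H (Suc n)"
    have "phi G H n (?cl h) = phi G H n (?cl \<one>)"
      using a H_carrier[OF n h] by (simp only: phi h one class_eq) simp
    then have "?cl h = ?cl \<one>" using inj h one unfolding inj_on_def C by blast
    then show "h \<in> H (Suc n)" using cl_eq[OF h one] H_carrier[OF n h] by simp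
  next
    assume *: "\<forall>h\<in>H n. aug G h \<in> filt G H (Suc n) \<longrightarrow> h \<in> H (Suc n)"
    show "inj_on (phi G H n) (carrier (C_grp G H n))"
      unfolding C inj_on_def using * by (auto simp: phi class_eq cl_eq div)
  qed
qed

end

lemma realizes_iff_trivial_coker:
  assumes "finite_N_series G H N" "\<forall>n\<in>{1..<N}. normalized_section G H n (s n)"
  shows "realizes G H \<longleftrightarrow> (\<forall>n\<in>{1..<N}. trivial_group (coker_R_bar G H n (s n)))"
proof -
  interpret N_series_group G H
    using assms(1) by (simp add: finite_N_series_def N_series_group_def N_series_group_axioms_def)
  \<comment> \<open>Past the end of the series C_n is trivial, while \<open>realizes\<close> ranges
    over all n \<ge> 1.\<close>
  have "inj_on (phi G H n) (carrier (C_grp G H n))" if "N \<le> n" for n :: nat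
  proof -
    have "1 \<le> n" "H n = {\<one>\<^bsub>G\<^esub>}" "H (Suc n) = {\<one>\<^bsub>G\<^esub>}"
      using assms(1) that by (auto simp: finite_N_series_def)
    then show ?thesis by (simp add: inj_phi_iff)
  qed
  moreover have "inj_on (phi G H n) (carrier (C_grp G H n)) \<longleftrightarrow> trivial_group (coker_R_bar G H n (s n))"
    if "n \<in> {1..<N}" for n :: nat
  proof -
    interpret N_series_section G H n "s n"
      using that assms(2) by unfold_locales auto
    show ?thesis using inj_phi_iff[of n] trivial_coker_iff by simp
  qed
  ultimately show ?thesis unfolding realizes_def
  proof (intro iffI ballI allI impI)
    fix n :: nat assume *: "\<And>n::nat. N \<le> n \<Longrightarrow> inj_on (phi G H n) (carrier (C_grp G H n))"
      "\<And>n. n \<in> {1..<N} \<Longrightarrow> inj_on (phi G H n) (carrier (C_grp G H n)) \<longleftrightarrow> trivial_group (coker_R_bar G H n (s n))"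
      "\<forall>n\<in>{1..<N}. trivial_group (coker_R_bar G H n (s n))" "1 \<le> n"
    then show "inj_on (phi G H n) (carrier (C_grp G H n))"
      by (cases "N \<le> n") auto
  qed auto
qed

section \<open>Programs\<close>

text \<open>\<open>computable F\<close>: wherever the arguments \<open>e\<close> reside below a register \<open>r\<close>, some program puts
  \<open>F T M e\<close> into \<open>r\<close> without touching the registers below \<open>r\<close> or the matrices \<open>T\<close>, \<open>M\<close>. A bound
  variable is \<open>e 0\<close>, and the other arguments are shifted by \<open>Suc\<close>.\<close>

definition computable :: "(int mat \<Rightarrow> int mat \<Rightarrow> (nat \<Rightarrow> int) \<Rightarrow> int) \<Rightarrow> bool" where
  "computable F \<longleftrightarrow> (\<forall>ms r. (\<forall>i. ms i < r) \<longrightarrow>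
     (\<exists>p. \<forall>st. \<exists>st'. exec p st st' \<and> fst st' r = F (snd st 0) (snd st 1) (fst st \<circ> ms) \<and>
        (\<forall>i<r. fst st' i = fst st i) \<and> snd st' = snd st))"

abbreviation decidable :: "(int mat \<Rightarrow> int mat \<Rightarrow> (nat \<Rightarrow> int) \<Rightarrow> bool) \<Rightarrow> bool" where
  "decidable P \<equiv> computable (\<lambda>T M e. of_bool (P T M e))"

text \<open>Because \<open>computable\<close> quantifies over all placements \<open>ms\<close>,
  renaming arguments moves no data: the placement is composed with f.\<close>

lemma computable_rename: "computable F \<Longrightarrow> computable (\<lambda>T M e. F T M (\<lambda>i. e (f i)))"
  unfolding computable_def
proof (intro allI impI)
  fix ms :: "nat \<Rightarrow> nat" and r assume F: "\<forall>ms r. (\<forall>i. ms i < r) \<longrightarrow>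
     (\<exists>p. \<forall>st. \<exists>st'. exec p st st' \<and> fst st' r = F (snd st 0) (snd st 1) (fst st \<circ> ms) \<and>
        (\<forall>i<r. fst st' i = fst st i) \<and> snd st' = snd st)" and ms: "\<forall>i. ms i < r"
  from F[rule_format, of "ms \<circ> f" r] ms
  show "\<exists>p. \<forall>st. \<exists>st'. exec p st st' \<and> fst st' r = F (snd st 0) (snd st 1) (\<lambda>i. (fst st \<circ> ms) (f i)) \<and>
        (\<forall>i<r. fst st' i = fst st i) \<and> snd st' = snd st"
    by (simp add: comp_def)
qed

lemma exec_SetIntI: "st' = ((fst st)(r := ieval e st), snd st) \<Longrightarrow> exec (SetInt r e) st st'"
  using exec_SetInt by simp

lemma computable_iexp:
  assumes "\<And>ms. \<exists>E. \<forall>st. ieval E st = F (snd st 0) (snd st 1) (fst st \<circ> ms)"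
  shows "computable F"
  unfolding computable_def
proof (intro allI impI)
  fix ms :: "nat \<Rightarrow> nat" and r assume ms: "\<forall>i. ms i < r"
  obtain E where E: "\<And>st. ieval E st = F (snd st 0) (snd st 1) (fst st \<circ> ms)" using assms by blast
  show "\<exists>p. \<forall>st. \<exists>st'. exec p st st' \<and> fst st' r = F (snd st 0) (snd st 1) (fst st \<circ> ms) \<and>
        (\<forall>i<r. fst st' i = fst st i) \<and> snd st' = snd st"
    by (intro exI[of _ "SetInt r E"] allI exI conjI, rule exec_SetInt) (auto simp: E)
qed

text \<open>Stack discipline: the value of A stays in register r as new argument 0 while F works
  from register r + 1 upwards; the result is then copied down to r.\<close>

lemma computable_let:
  assumes A: "computable A" and F: "computable (\<lambda>T M e. F T M (e 0) (\<lambda>i. e (Suc i)))"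
  shows "computable (\<lambda>T M e. F T M (A T M e) e)"
  unfolding computable_def
proof (intro allI impI)
  fix ms :: "nat \<Rightarrow> nat" and r assume ms: "\<forall>i. ms i < (r::nat)"
  from A ms obtain p where p: "\<And>st. \<exists>st'. exec p st st' \<and> fst st' r = A (snd st 0) (snd st 1) (fst st \<circ> ms) \<and>
        (\<forall>i<r. fst st' i = fst st i) \<and> snd st' = snd st"
    unfolding computable_def by blast
  let ?ms = "case_nat r ms"
  have "\<forall>i. ?ms i < Suc r" using ms by (auto split: nat.split intro: less_SucI)
  then have "\<exists>q. \<forall>st. \<exists>st'. exec q st st' \<and>
       fst st' (Suc r) = F (snd st 0) (snd st 1) ((fst st \<circ> ?ms) 0) (\<lambda>i. (fst st \<circ> ?ms) (Suc i)) \<and>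
        (\<forall>i<Suc r. fst st' i = fst st i) \<and> snd st' = snd st"
    using F unfolding computable_def by blast
  then obtain q where "\<forall>st. \<exists>st'. exec q st st' \<and>
       fst st' (Suc r) = F (snd st 0) (snd st 1) ((fst st \<circ> ?ms) 0) (\<lambda>i. (fst st \<circ> ?ms) (Suc i)) \<and>
        (\<forall>i<Suc r. fst st' i = fst st i) \<and> snd st' = snd st" by blast
  then have q: "\<And>st. \<exists>st'. exec q st st' \<and>
       fst st' (Suc r) = F (snd st 0) (snd st 1) (fst st r) (\<lambda>i. fst st (ms i)) \<and>
        (\<forall>i<Suc r. fst st' i = fst st i) \<and> snd st' = snd st"
    by (simp only: comp_def nat.case)
  show "\<exists>p. \<forall>st. \<exists>st'. exec p st st' \<and>
      fst st' r = F (snd st 0) (snd st 1) (A (snd st 0) (snd st 1) (fst st \<circ> ms)) (fst st \<circ> ms) \<and>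
        (\<forall>i<r. fst st' i = fst st i) \<and> snd st' = snd st"
  proof (intro exI[of _ "Seq p (Seq q (SetInt r (IReg (Suc r))))"] allI)
    fix st
    obtain st1 where 1: "exec p st st1" "fst st1 r = A (snd st 0) (snd st 1) (fst st \<circ> ms)"
        "\<forall>i<r. fst st1 i = fst st i" "snd st1 = snd st" using p by blast
    obtain st2 where 2: "exec q st1 st2"
       "fst st2 (Suc r) = F (snd st1 0) (snd st1 1) (fst st1 r) (\<lambda>i. fst st1 (ms i))"
        "\<forall>i<Suc r. fst st2 i = fst st1 i" "snd st2 = snd st1" using q by blast
    have "(\<lambda>i. fst st1 (ms i)) = fst st \<circ> ms" using 1(3) ms by auto
    then show "\<exists>st'. exec (Seq p (Seq q (SetInt r (IReg (Suc r))))) st st' \<and>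
       fst st' r = F (snd st 0) (snd st 1) (A (snd st 0) (snd st 1) (fst st \<circ> ms)) (fst st \<circ> ms) \<and>
        (\<forall>i<r. fst st' i = fst st i) \<and> snd st' = snd st"
      using 1 2 by (intro exI[of _ "((fst st2)(r := ieval (IReg (Suc r)) st2), snd st2)"] conjI exec_Seq[OF 1(1)]
          exec_Seq[OF 2(1)] exec_SetInt) auto
  qed
qed

lemma computable_binary:
  assumes g: "computable (\<lambda>T M e. g T M (e 0) (e 1))" and A: "computable A" and B: "computable B"
  shows "computable (\<lambda>T M e. g T M (A T M e) (B T M e))"
proof (rule computable_let[OF B, of "\<lambda>T M y e. g T M (A T M e) y"])
  have "computable (\<lambda>T M e. A T M (\<lambda>i. e (Suc i)))" by (rule computable_rename[OF A])
  then show "computable (\<lambda>T M e. g T M (A T M (\<lambda>i. e (Suc i))) (e 0))"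
    by (rule computable_let[of _ "\<lambda>T M x e. g T M x (e 0)"]) (use g in simp)
qed

section \<open>Closure under arithmetic, bounded recursion and bounded quantifiers\<close>

lemma computable_const: "computable (\<lambda>T M e. c)"
  by (rule computable_iexp, rule exI[of _ "IConst c"]) simp

lemma computable_var: "computable (\<lambda>T M e. e i)"
  by (rule computable_iexp, rule_tac x="IReg (ms i)" in exI) simp

lemma computable_rows: "computable (\<lambda>T M e. int (dim_row T))"
  by (rule computable_iexp, rule exI[of _ "IRows 0"]) simp

lemma computable_entry:
  assumes "computable A" "computable B"
  shows "computable (\<lambda>T M e. mat_get T (A T M e) (B T M e))" "computable (\<lambda>T M e. mat_get M (A T M e) (B T M e))"
proof -
  have "computable (\<lambda>T M e. mat_get T (e 0) (e 1))"
    by (rule computable_iexp, rule_tac x="IEntry 0 (IReg (ms 0)) (IReg (ms 1))" in exI) simp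
  from computable_binary[OF this assms] show "computable (\<lambda>T M e. mat_get T (A T M e) (B T M e))" .
  have "computable (\<lambda>T M e. mat_get M (e 0) (e 1))"
    by (rule computable_iexp, rule_tac x="IEntry 1 (IReg (ms 0)) (IReg (ms 1))" in exI) simp
  from computable_binary[OF this assms] show "computable (\<lambda>T M e. mat_get M (A T M e) (B T M e))" .
qed

lemma computable_arith:
  assumes "computable A" "computable B"
  shows computable_add: "computable (\<lambda>T M e. A T M e + B T M e)"
    and computable_diff: "computable (\<lambda>T M e. A T M e - B T M e)"
    and computable_mult: "computable (\<lambda>T M e. A T M e * B T M e)"
    and computable_div: "computable (\<lambda>T M e. A T M e div B T M e)"
    and decidable_less: "decidable (\<lambda>T M e. A T M e < B T M e)"
proof -
  have "computable (\<lambda>T M e. e 0 + e 1)"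
    by (rule computable_iexp, rule_tac x="IAdd (IReg (ms 0)) (IReg (ms 1))" in exI) simp
  from computable_binary[OF this assms] show "computable (\<lambda>T M e. A T M e + B T M e)" .
  have "computable (\<lambda>T M e. e 0 - e 1)"
    by (rule computable_iexp, rule_tac x="ISub (IReg (ms 0)) (IReg (ms 1))" in exI) simp
  from computable_binary[OF this assms] show "computable (\<lambda>T M e. A T M e - B T M e)" .
  have "computable (\<lambda>T M e. e 0 * e 1)"
    by (rule computable_iexp, rule_tac x="IMul (IReg (ms 0)) (IReg (ms 1))" in exI) simp
  from computable_binary[OF this assms] show "computable (\<lambda>T M e. A T M e * B T M e)" .
  have "computable (\<lambda>T M e. e 0 div e 1)"
    by (rule computable_iexp, rule_tac x="IDiv (IReg (ms 0)) (IReg (ms 1))" in exI) simp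
  from computable_binary[OF this assms] show "computable (\<lambda>T M e. A T M e div B T M e)" .
  have "decidable (\<lambda>T M e. e 0 < e 1)"
    by (rule computable_iexp, rule_tac x="ILess (IReg (ms 0)) (IReg (ms 1))" in exI) simp
  from computable_binary[OF this assms] show "decidable (\<lambda>T M e. A T M e < B T M e)" .
qed

lemma computable_mod:
  assumes "computable A" "computable B"
  shows "computable (\<lambda>T M e. A T M e mod B T M e)"
  unfolding minus_mult_div_eq_mod[symmetric]
  by (intro computable_arith assms)

lemma decidable_not: "decidable P \<Longrightarrow> decidable (\<lambda>T M e. \<not> P T M e)"
  unfolding of_bool_not_iff by (intro computable_arith computable_const)

lemma decidable_conj: "decidable P \<Longrightarrow> decidable Q \<Longrightarrow> decidable (\<lambda>T M e. P T M e \<and> Q T M e)"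
  unfolding of_bool_conj by (intro computable_arith)

lemma decidable_imp: "decidable P \<Longrightarrow> decidable Q \<Longrightarrow> decidable (\<lambda>T M e. P T M e \<longrightarrow> Q T M e)"
  using decidable_not[OF decidable_conj[OF _ decidable_not], of P Q] by simp

lemma decidable_le:
  assumes "computable A" "computable B" shows "decidable (\<lambda>T M e. A T M e \<le> B T M e)"
  using decidable_not[OF decidable_less[OF assms(2,1)]] by (simp add: not_less)

lemma decidable_eq:
  assumes "computable A" "computable B" shows "decidable (\<lambda>T M e. A T M e = B T M e)"
  using decidable_conj[OF decidable_le[OF assms] decidable_le[OF assms(2,1)]] by (simp add: eq_iff)

text \<open>The source of all loops. Register r holds the accumulator, r + 1 the counter, and the
  body works from r + 2 upwards. The loop bound lies below r, where the body cannot change it, so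
  the loop terminates.\<close>

lemma computable_rec:
  assumes A: "computable A" and B: "computable B"
    and F: "computable (\<lambda>T M e. F T M (e 0) (e 1) (\<lambda>i. e (Suc (Suc i))))"
  shows "computable (\<lambda>T M e. rec_nat (A T M e) (\<lambda>i x. F T M (int i) x e) (nat (B T M e)))"
proof -
  have core: "computable (\<lambda>T M e. rec_nat (e 0) (\<lambda>i x. F T M (int i) x (\<lambda>i. e (Suc (Suc i)))) (nat (e 1)))"
    unfolding computable_def
  proof (intro allI impI)
    fix ms :: "nat \<Rightarrow> nat" and r assume ms: "\<forall>i. ms i < (r::nat)"
    define ms' where "ms' = (\<lambda>i. ms (Suc (Suc i)))"
    let ?ms = "case_nat (Suc r) (case_nat r ms')"
    have "\<forall>i. ?ms i < Suc (Suc r)" using ms by (auto simp: ms'_def split: nat.split intro: less_SucI)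
    then have "\<exists>p. \<forall>st. \<exists>st'. exec p st st' \<and>
       fst st' (Suc (Suc r)) = F (snd st 0) (snd st 1) ((fst st \<circ> ?ms) 0) ((fst st \<circ> ?ms) 1) (\<lambda>i. (fst st \<circ> ?ms) (Suc (Suc i))) \<and>
        (\<forall>i<Suc (Suc r). fst st' i = fst st i) \<and> snd st' = snd st"
      using F unfolding computable_def by blast
    then obtain p where "\<forall>st. \<exists>st'. exec p st st' \<and>
       fst st' (Suc (Suc r)) = F (snd st 0) (snd st 1) ((fst st \<circ> ?ms) 0) ((fst st \<circ> ?ms) 1) (\<lambda>i. (fst st \<circ> ?ms) (Suc (Suc i))) \<and>
        (\<forall>i<Suc (Suc r). fst st' i = fst st i) \<and> snd st' = snd st" by blast
    then have p: "\<And>st. \<exists>st'. exec p st st' \<and>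
       fst st' (Suc (Suc r)) = F (snd st 0) (snd st 1) (fst st (Suc r)) (fst st r) (fst st \<circ> ms') \<and>
        (\<forall>i<Suc (Suc r). fst st' i = fst st i) \<and> snd st' = snd st"
      by (simp only: comp_def nat.case One_nat_def)
    let ?body = "Seq p (Seq (SetInt r (IReg (Suc (Suc r)))) (SetInt (Suc r) (IAdd (IReg (Suc r)) (IConst 1))))"
    let ?test = "ILess (IReg (Suc r)) (IReg (ms 1))"
    let ?rec = "\<lambda>st. rec_nat (fst st (ms 0)) (\<lambda>i x. F (snd st 0) (snd st 1) (int i) x (fst st \<circ> ms'))"
    have body: "\<exists>st'. exec ?body st st' \<and> fst st' (Suc r) = fst st (Suc r) + 1 \<and>
        fst st' r = F (snd st 0) (snd st 1) (fst st (Suc r)) (fst st r) (fst st \<circ> ms') \<and>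
        (\<forall>i<r. fst st' i = fst st i) \<and> snd st' = snd st" for st
    proof -
      obtain st1 where 1: "exec p st st1"
       "fst st1 (Suc (Suc r)) = F (snd st 0) (snd st 1) (fst st (Suc r)) (fst st r) (fst st \<circ> ms')"
        "\<forall>i<Suc (Suc r). fst st1 i = fst st i" "snd st1 = snd st" using p by blast
      show ?thesis
        using 1 by (intro exI[of _ "((fst st1)(r := fst st1 (Suc (Suc r)), Suc r := fst st1 (Suc r) + 1), snd st1)"] conjI
           exec_Seq[OF 1(1) exec_Seq[OF exec_SetInt exec_SetIntI]]) auto
    qed
    \<comment> \<open>The invariant starts at an arbitrary k and the induction runs downwards from
      the bound, since \<open>exec_WhileTrue\<close> peels off the first iteration.\<close>
    have loop: "\<exists>st'. exec (While ?test ?body) st st' \<and> fst st' r = ?rec st0 N \<and>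
        (\<forall>i<r. fst st' i = fst st0 i) \<and> snd st' = snd st0"
      if "k \<le> N" "N = nat (fst st0 (ms 1))" "fst st (Suc r) = int k" "fst st r = ?rec st0 k"
        "\<forall>i<r. fst st i = fst st0 i" "snd st = snd st0" for k N st st0
      using that(1,3-)
    proof (induction k arbitrary: st rule: inc_induct)
      case base
      have "ieval ?test st = 0"
        using base ms that(2) by simp
      then have "exec (While ?test ?body) st st" by (rule exec_WhileFalse)
      then show ?case using base by blast
    next
      case (step k)
      have "ieval ?test st \<noteq> 0"
        using step ms that(2) by simp
      moreover obtain st1 where 1: "exec ?body st st1" "fst st1 (Suc r) = fst st (Suc r) + 1"
        "fst st1 r = F (snd st 0) (snd st 1) (fst st (Suc r)) (fst st r) (fst st \<circ> ms')"
        "\<forall>i<r. fst st1 i = fst st i" "snd st1 = snd st" using body by blast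
      have "fst st \<circ> ms' = fst st0 \<circ> ms'" using step ms by (auto simp: ms'_def)
      then have rec: "fst st1 r = ?rec st0 (Suc k)" using 1 step by (simp add: comp_def)
      have "fst st1 (Suc r) = int (Suc k)" "\<forall>i<r. fst st1 i = fst st0 i" "snd st1 = snd st0"
        using 1 step by simp_all
      then obtain st' where "exec (While ?test ?body) st1 st'" "fst st' r = ?rec st0 N"
        "\<forall>i<r. fst st' i = fst st0 i" "snd st' = snd st0"
        using step.IH[OF _ rec] by blast
      ultimately show ?case using 1(1) exec_WhileTrue by blast
    qed
    show "\<exists>p. \<forall>st. \<exists>st'. exec p st st' \<and> fst st' r =
         rec_nat ((fst st \<circ> ms) 0) (\<lambda>i x. F (snd st 0) (snd st 1) (int i) x (\<lambda>i. (fst st \<circ> ms) (Suc (Suc i)))) (nat ((fst st \<circ> ms) 1)) \<and>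
        (\<forall>i<r. fst st' i = fst st i) \<and> snd st' = snd st"
    proof (intro exI[of _ "Seq (SetInt r (IReg (ms 0))) (Seq (SetInt (Suc r) (IConst 0)) (While ?test ?body))"] allI)
      fix st :: state
      let ?st1 = "((fst st)(r := ieval (IReg (ms 0)) st), snd st)"
      let ?st2 = "((fst ?st1)(Suc r := ieval (IConst 0) ?st1), snd ?st1)"
      obtain st' where st': "exec (While ?test ?body) ?st2 st'" "fst st' r = ?rec st (nat (fst st (ms 1)))"
         "\<forall>i<r. fst st' i = fst st i" "snd st' = snd st"
        using loop[of 0 "nat (fst st (ms 1))" st ?st2] by auto
      then show "\<exists>st'. exec (Seq (SetInt r (IReg (ms 0))) (Seq (SetInt (Suc r) (IConst 0)) (While ?test ?body))) st st' \<and>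
         fst st' r = rec_nat ((fst st \<circ> ms) 0) (\<lambda>i x. F (snd st 0) (snd st 1) (int i) x (\<lambda>i. (fst st \<circ> ms) (Suc (Suc i)))) (nat ((fst st \<circ> ms) 1)) \<and>
        (\<forall>i<r. fst st' i = fst st i) \<and> snd st' = snd st"
        by (intro exI[of _ st'] conjI exec_Seq[OF exec_SetInt] st'(1)) (auto simp: ms'_def comp_def)
    qed
  qed
  have B': "computable (\<lambda>T M e. B T M (\<lambda>i. e (Suc i)))" by (rule computable_rename[OF B])
  let ?R = "\<lambda>T M x e. rec_nat x (\<lambda>i x. F T M (int i) x (\<lambda>i. e (Suc i))) (nat (e 0))"
  have 1: "computable (\<lambda>T M e. ?R T M (A T M (\<lambda>i. e (Suc i))) e)"
    by (rule computable_let[OF computable_rename[OF A]]) (use core in simp)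
  show ?thesis
    by (rule computable_let[OF B, of "\<lambda>T M y e. rec_nat (A T M e) (\<lambda>i x. F T M (int i) x e) (nat y)"]) (rule 1)
qed

lemma sum_rec: "(\<Sum>i\<in>{0..<b}. f i) = rec_nat 0 (\<lambda>i x. x + f (int i)) (nat b)" for f :: "int \<Rightarrow> int"
proof -
  have "(\<Sum>i\<in>{0..<int n}. f i) = rec_nat 0 (\<lambda>i x. x + f (int i)) n" for n
  proof (induction n)
    case (Suc n)
    have "{0..<int (Suc n)} = insert (int n) {0..<int n}" by auto
    then show ?case using Suc by simp
  qed simp
  from this[of "nat b"] show ?thesis by (cases "0 \<le> b") auto
qed

lemma computable_sum:
  assumes "computable B" "computable (\<lambda>T M e. F T M (e 0) (\<lambda>i. e (Suc i)))"
  shows "computable (\<lambda>T M e. \<Sum>i\<in>{0..<B T M e}. F T M i e)"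
  unfolding sum_rec
proof (rule computable_rec[OF computable_const assms(1), of "\<lambda>T M i x e. x + F T M i e"])
  \<comment> \<open>Inside the recursion, argument 0 is the index and argument 1 the accumulator;
    the renaming skips the latter for the summand.\<close>
  have "computable (\<lambda>T M e. F T M (e 0) (\<lambda>i. e (Suc (Suc i))))"
    using computable_rename[OF assms(2), of "case_nat 0 (\<lambda>i. Suc (Suc i))"] by simp
  then show "computable (\<lambda>T M e. e 1 + F T M (e 0) (\<lambda>i. e (Suc (Suc i))))"
    by (intro computable_add computable_var)
qed

lemma computable_power:
  assumes "computable A" "computable B"
  shows "computable (\<lambda>T M e. A T M e ^ nat (B T M e))"
proof -
  have "computable (\<lambda>T M e. rec_nat 1 (\<lambda>i x. A T M e * x) (nat (B T M e)))"
    by (rule computable_rec[OF computable_const assms(2), of "\<lambda>T M i x e. A T M e * x"])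
      (intro computable_mult computable_var computable_rename[OF assms(1)])
  moreover have "rec_nat 1 (\<lambda>i x. a * x) n = a ^ n" for a :: int and n by (induction n) auto
  ultimately show ?thesis by simp
qed

text \<open>Counterexamples are counted by a computable sum, so bounded quantifiers, and with them
  the search for a family, reduce to bounded recursion.\<close>

lemma decidable_ball:
  assumes "computable B" "decidable (\<lambda>T M e. P T M (e 0) (\<lambda>i. e (Suc i)))"
  shows "decidable (\<lambda>T M e. \<forall>i\<in>{0..<B T M e}. P T M i e)"
proof -
  have "decidable (\<lambda>T M e. (\<Sum>i\<in>{0..<B T M e}. of_bool (\<not> P T M i e)) = (0::int))"
    by (intro decidable_eq computable_sum decidable_not computable_const assms)
  moreover have "(\<Sum>i\<in>{0..<n}. of_bool (\<not> p i)) = (0::int) \<longleftrightarrow> (\<forall>i\<in>{0..<n}. p i)" for n :: int and p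
    by (subst sum_nonneg_eq_0_iff) auto
  ultimately show ?thesis by (simp only:)
qed

lemma decidable_bex:
  assumes "computable B" "decidable (\<lambda>T M e. P T M (e 0) (\<lambda>i. e (Suc i)))"
  shows "decidable (\<lambda>T M e. \<exists>i\<in>{0..<B T M e}. P T M i e)"
  using decidable_not[OF decidable_ball[OF assms(1) decidable_not[OF assms(2)]]] by simp

lemmas computable_intros = computable_const computable_var computable_rows computable_entry computable_arith
  computable_mod computable_sum computable_power decidable_not decidable_conj decidable_imp decidable_le
  decidable_eq decidable_ball decidable_bex

text \<open>All arguments are placed at register 0, where the input n resides; the result is
  computed in register 1 and copied back.\<close>

lemma decidable_program:
  assumes "decidable P"
  obtains p where "\<And>T M n. answers p (input_state T M n) (P T M (\<lambda>_. int n))"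
proof -
  from assms obtain p where p: "\<And>st. \<exists>st'. exec p st st' \<and> fst st' 1 = of_bool (P (snd st 0) (snd st 1) (fst st \<circ> (\<lambda>_. 0))) \<and>
        (\<forall>i<1. fst st' i = fst st i) \<and> snd st' = snd st"
    using assms[unfolded computable_def, rule_format, of "\<lambda>_. 0" 1] by blast
  have "answers (Seq p (SetInt 0 (IReg 1))) (input_state T M n) (P T M (\<lambda>_. int n))" for T M n
  proof -
    let ?st = "input_state T M n"
    obtain st' where st': "exec p ?st st'" "fst st' 1 = of_bool (P (snd ?st 0) (snd ?st 1) (fst ?st \<circ> (\<lambda>_. 0)))"
      using p by blast
    then have "fst st' 1 = of_bool (P T M (\<lambda>_. int n))"
      by (simp add: input_state_def comp_def)
    then show ?thesis unfolding answers_def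
      by (intro exI[of _ "((fst st')(0 := ieval (IReg 1) st'), snd st')"] conjI exec_Seq[OF st'(1)] exec_SetInt) simp
  qed
  then show ?thesis by (rule that)
qed

section \<open>Testing injectivity by bounded search\<close>

definition digit :: "int \<Rightarrow> int \<Rightarrow> int \<Rightarrow> int" where
  "digit b c i = c div b ^ nat i mod b"

text \<open>A vector over \<int>/b as an integer below b^k, with the reduced coordinates as base-b
  digits; equal codes mean congruent vectors.\<close>

definition encode :: "int \<Rightarrow> int \<Rightarrow> (int \<Rightarrow> int) \<Rightarrow> int" where
  "encode b k w = (\<Sum>i\<in>{0..<k}. (w i mod b) * b ^ nat i)"

lemma encode_Suc: "encode b (int (Suc K)) w = encode b (int K) w + (w (int K) mod b) * b ^ K"
proof -
  have "{0..<int (Suc K)} = insert (int K) {0..<int K}" by auto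
  then show ?thesis by (simp add: encode_def)
qed

lemma encode_bounds:
  assumes "0 < b" shows "0 \<le> encode b (int K) w" "encode b (int K) w < b ^ K"
proof -
  show "0 \<le> encode b (int K) w" unfolding encode_def using assms by (intro sum_nonneg) auto
  show "encode b (int K) w < b ^ K"
  proof (induction K)
    case (Suc K)
    have "w (int K) mod b + 1 \<le> b" using pos_mod_bound[OF assms, of "w (int K)"] by linarith
    then have "(w (int K) mod b + 1) * b ^ K \<le> b * b ^ K" using assms by (intro mult_right_mono) auto
    with Suc show ?case by (simp add: encode_Suc algebra_simps del: of_nat_Suc)
  qed (simp add: encode_def)
qed

lemma digit_encode_nat:
  assumes b: "0 < b" shows "j < K \<Longrightarrow> digit b (encode b (int K) w) (int j) = w (int j) mod b"
proof (induction K)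
  case (Suc K)
  have "encode b (int (Suc K)) w div b ^ j mod b = w (int j) mod b"
  proof (cases "j = K")
    case True
    have "(encode b (int K) w + (w (int K) mod b) * b ^ K) div b ^ K = w (int K) mod b"
      using b encode_bounds[OF b, of K w] by simp
    then show ?thesis using True by (simp add: encode_Suc del: of_nat_Suc)
  next
    case False
    then have j: "j < K" using Suc.prems by simp
    \<comment> \<open>One factor b is kept apart: after division by b^j the top term is still a
      multiple of b and leaves digit j unchanged.\<close>
    have "b ^ K = b ^ (K - Suc j) * b * b ^ j" using j
      by (metis Suc_diff_Suc mult.commute mult.left_commute power_Suc power_add le_add_diff_inverse2 less_imp_le)
    then have "encode b (int (Suc K)) w div b ^ j =
        (encode b (int K) w + ((w (int K) mod b) * b ^ (K - Suc j) * b) * b ^ j) div b ^ j"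
      by (simp add: encode_Suc mult.assoc del: of_nat_Suc)
    also have "\<dots> = encode b (int K) w div b ^ j + (w (int K) mod b) * b ^ (K - Suc j) * b"
      using b by simp
    finally show ?thesis using Suc.IH j by (simp add: digit_def)
  qed
  then show ?case by (simp add: digit_def)
qed simp

lemma digit_encode:
  assumes "0 < b" "0 \<le> j" "j < int K" shows "digit b (encode b (int K) w) j = w j mod b"
  using digit_encode_nat[OF assms(1), of "nat j" K w] assms by simp

lemma encode_cong:
  assumes "\<And>i. 0 \<le> i \<Longrightarrow> i < k \<Longrightarrow> w i mod b = w' i mod b" shows "encode b k w = encode b k w'"
  unfolding encode_def using assms by (intro sum.cong) auto

lemma encode_eqD:
  assumes "0 < b" "encode b (int K) w = encode b (int K) w'" "0 \<le> i" "i < int K"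
  shows "w i mod b = w' i mod b"
  using digit_encode[OF assms(1,3,4), of w] digit_encode[OF assms(1,3,4), of w'] assms(2) by simp

definition code_diff :: "int \<Rightarrow> int \<Rightarrow> int \<Rightarrow> int \<Rightarrow> int" where
  "code_diff b k v w = encode b k (\<lambda>g. digit b v g - digit b w g)"

text \<open>Left multiplication by x - 1 on codes. The coefficient of g in x v is found by scanning
  the row of x for entries g, which avoids inverses.\<close>

definition code_aug_mult :: "int mat \<Rightarrow> int \<Rightarrow> int \<Rightarrow> int \<Rightarrow> int \<Rightarrow> int" where
  "code_aug_mult T b k x v =
     encode b k (\<lambda>g. (\<Sum>y\<in>{0..<k}. of_bool (mat_get T x y = g) * digit b v y) - digit b v g)"

text \<open>U is a table of bits with rows of length V, the number of vectors: bit iV + v records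
  whether the vector with code v lies in the i-th subset.\<close>

definition has_bit :: "int \<Rightarrow> int \<Rightarrow> int \<Rightarrow> int \<Rightarrow> bool" where
  "has_bit U V i v \<longleftrightarrow> digit 2 U (i * V + v) = 1"

text \<open>\<open>U\<close> encodes a family of subgroups \<open>U\<^sub>0, \<dots>, U\<^sub>m\<close> of \<open>(\<int>/b)\<^sup>k\<close> with \<open>U\<^sub>0\<close> the whole module and
  \<open>(x - 1) U\<^sub>i\<^sub>-\<^sub>a \<subseteq> U\<^sub>i\<close> for \<open>x \<in> H\<^sub>a\<close>; the smallest such family consists of the images of
  \<open>A\<^sub>0, \<dots>, A\<^sub>m\<close>.\<close>

definition admissible :: "int mat \<Rightarrow> int mat \<Rightarrow> int \<Rightarrow> int \<Rightarrow> int \<Rightarrow> int \<Rightarrow> int \<Rightarrow> bool" where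
  "admissible T M b k V m U \<longleftrightarrow>
     (\<forall>g\<in>{0..<k}. has_bit U V 0 (encode b k (\<lambda>i. of_bool (i = g)))) \<and>
     (\<forall>i\<in>{0..<m + 1}. has_bit U V i 0 \<and>
        (\<forall>v\<in>{0..<V}. \<forall>w\<in>{0..<V}. has_bit U V i v \<and> has_bit U V i w \<longrightarrow> has_bit U V i (code_diff b k v w))) \<and>
     (\<forall>i\<in>{0..<m + 1}. \<forall>a\<in>{0..<i + 1}. \<forall>x\<in>{0..<k}. 1 \<le> a \<and> \<not> mat_get M (a - 1) x = 0 \<longrightarrow>
        (\<forall>v\<in>{0..<V}. has_bit U V (i - a) v \<longrightarrow> has_bit U V i (code_aug_mult T b k x v)))"

text \<open>The identity element is recognized as the only idempotent \<open>u\<close>.\<close>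

definition excluded :: "int mat \<Rightarrow> int mat \<Rightarrow> int \<Rightarrow> int \<Rightarrow> int \<Rightarrow> int \<Rightarrow> int \<Rightarrow> bool" where
  "excluded T M b k V m h \<longleftrightarrow>
     (\<exists>U\<in>{0..<2 ^ nat ((m + 1) * V)}. admissible T M b k V m U \<and>
       (\<exists>u\<in>{0..<k}. mat_get T u u = u \<and> \<not> has_bit U V m (encode b k (\<lambda>g. of_bool (g = h) - of_bool (g = u)))))"

text \<open>Rows of \<open>M\<close> are counted from 0, so row n - 1 is H_n and row n is H_{n+1}.
  The modulus is |G|^n, and the next power is the number of vectors over it.\<close>

definition phi_injective_test :: "int mat \<Rightarrow> int mat \<Rightarrow> int \<Rightarrow> bool" where
  "phi_injective_test T M n \<longleftrightarrow>
     (\<forall>h\<in>{0..<int (dim_row T)}. \<not> mat_get M (n - 1) h = 0 \<and> mat_get M n h = 0 \<longrightarrow>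
        excluded T M (int (dim_row T) ^ nat n) (int (dim_row T))
          ((int (dim_row T) ^ nat n) ^ nat (int (dim_row T))) (n + 1) h)"

section \<open>The group order and reduction modulo its powers\<close>

locale finite_N_series_group = N_series_group +
  assumes fin: "finite (carrier G)"
begin

text \<open>The augmentation of the group ring, with kernel A_1 by \<open>eps_filt\<close> and
  \<open>filt_1I\<close>.\<close>

definition eps :: "('a \<Rightarrow>\<^sub>0 int) \<Rightarrow> int" where
  "eps p = (\<Sum>g\<in>carrier G. Poly_Mapping.lookup p g)"

lemma eps_simps: "eps (a - b) = eps a - eps b" "eps 0 = 0" "eps (frag_cmul c a) = c * eps a"
  by (simp_all add: eps_def lookup_minus sum_subtractf sum_distrib_left)

lemma eps_frag_of: "g \<in> carrier G \<Longrightarrow> eps (frag_of g) = 1"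
  using fin by (simp add: eps_def)

lemma eps_aug_mult:
  assumes "x \<in> carrier G" "Poly_Mapping.keys p \<subseteq> carrier G" shows "eps (aug_mult G x p) = 0"
  using assms(2)
proof (induction p rule: frag_induction)
  case (one g)
  then show ?case using assms(1) by (simp add: aug_mult_frag_of eps_simps eps_frag_of)
qed (simp_all add: aug_mult_simps eps_simps)

lemma eps_filt:
  assumes "1 \<le> m" "u \<in> filt G H m" shows "eps u = 0"
  using assms(2)
proof (induction rule: filt_induct)
  case (prod ps)
  show ?case
  proof (cases ps)
    case Nil then show ?thesis using prod assms(1) by simp
  next
    case (Cons xa qs)
    then show ?thesis using prod keys_aug_prod[of qs] eps_aug_mult H_carrier
      by (cases xa) auto
  qed
qed (simp_all add: eps_simps)

lemma filt_1I:
  assumes "Poly_Mapping.keys p \<subseteq> carrier G" "eps p = 0" shows "p \<in> filt G H 1"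
proof -
  \<comment> \<open>Subtracting the augmentation makes the statement additive in p, hence provable
    on single group elements.\<close>
  have "p - frag_cmul (eps p) (frag_of \<one>) \<in> filt G H 1"
    using assms(1)
  proof (induction p rule: frag_induction)
    case (one g)
    then show ?case using aug_filt_1[of g] by (simp add: eps_frag_of aug_def)
  next
    case (diff a b)
    have "a - b - frag_cmul (eps (a - b)) (frag_of \<one>) =
       (a - frag_cmul (eps a) (frag_of \<one>)) - (b - frag_cmul (eps b) (frag_of \<one>))"
      by (simp only: eps_simps frag_cmul_diff_distrib) simp
    with filt_diff[OF diff] show ?case by (simp only:)
  qed (simp add: eps_simps)
  with assms(2) show ?thesis by simp
qed

abbreviation "k \<equiv> card (carrier G)"

text \<open>Since \<open>(x - 1) \<Sum>\<^sub>y y = 0\<close>, multiplication by the group order \<open>k\<close> sends \<open>x - 1\<close> to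
  \<open>- (x - 1) \<Sum>\<^sub>y (y - 1)\<close>, one step further down the filtration.\<close>

lemma order_aug:
  assumes "1 \<le> a" "x \<in> H a" shows "frag_cmul (int k) (aug G x) \<in> filt G H (Suc a)"
proof -
  let ?S = "\<lambda>f. (\<Sum>y\<in>carrier G. f y) :: 'a \<Rightarrow>\<^sub>0 int"
  have x: "x \<in> carrier G" using assms H_carrier by blast
  have sum: "aug_mult G x (?S f) = ?S (\<lambda>y. aug_mult G x (f y))" for f
    using fin by (induction rule: finite_induct) (simp_all add: aug_mult_simps)
  have inS: "?S (aug G) \<in> filt G H 1"
    using fin subset_refl[of "carrier G"]
    by (induction rule: finite_subset_induct) (simp_all add: filt_add aug_filt_1 del: One_nat_def)
  have "?S (\<lambda>y. frag_of (x \<otimes> y)) = ?S frag_of"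
    by (rule sum.reindex_bij_witness[of _ "\<lambda>y. inv x \<otimes> y" "\<lambda>y. x \<otimes> y"]) (use x in \<open>auto simp: m_assoc[symmetric]\<close>)
  then have 0: "aug_mult G x (?S frag_of) = 0"
    by (simp add: sum aug_mult_frag_of sum_subtractf cong: sum.cong)
  have c: "(\<Sum>y\<in>A. p) = frag_cmul (int (card A)) p" if "finite A" for p :: "'a \<Rightarrow>\<^sub>0 int" and A :: "'a set"
    using that by (induction rule: finite_induct) (simp_all add: frag_cmul_distrib)
  have "?S (aug G) = ?S frag_of - frag_cmul (int k) (frag_of \<one>)"
    using c[OF fin] by (simp add: aug_def sum_subtractf)
  then have "aug_mult G x (?S (aug G)) = - frag_cmul (int k) (aug G x)"
    using x by (simp add: aug_mult_simps aug_mult_cmul 0 aug_mult_one)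
  moreover have "aug_mult G x (?S (aug G)) \<in> filt G H (a + 1)"
    using assms inS by (intro aug_mult_filt)
  ultimately show ?thesis using filt_minus[of "- frag_cmul (int k) (aug G x)"] by simp
qed

text \<open>The scalar is pushed to the last factor, where \<open>order_aug\<close> gains one unit
  of weight.\<close>

lemma order_aug_prod:
  "graded H ps \<Longrightarrow> ps \<noteq> [] \<Longrightarrow> frag_cmul (int k) (aug_prod G ps) \<in> filt G H (Suc (weight ps))"
proof (induction ps)
  case (Cons xa ps)
  obtain x a where xa: "xa = (x, a)" by force
  then have a: "1 \<le> a" "x \<in> H a" "graded H ps" using Cons by auto
  show ?case
  proof (cases "ps = []")
    case True
    then show ?thesis using order_aug[OF a(1,2)] xa a H_carrier
      by (simp add: one_group_ring aug_mult_one)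
  next
    case False
    then have "aug_mult G x (frag_cmul (int k) (aug_prod G ps)) \<in> filt G H (a + Suc (weight ps))"
      using Cons.IH a by (intro aug_mult_filt) auto
    then show ?thesis by (simp add: aug_mult_cmul xa)
  qed
qed simp

lemma order_filt:
  assumes "1 \<le> m" "u \<in> filt G H m" shows "frag_cmul (int k) u \<in> filt G H (Suc m)"
  using assms(2)
proof (induction rule: filt_induct)
  case (prod ps)
  then have "ps \<noteq> []" using assms(1) by auto
  with prod order_aug_prod filt_anti[of "Suc m" "Suc (weight ps)"] show ?case by auto
qed (auto simp: frag_cmul_minus filt_diff)

lemma order_power_filt:
  assumes "u \<in> filt G H 1" shows "frag_cmul (int k ^ n) u \<in> filt G H (Suc n)"
proof (induction n)
  case (Suc n)
  then show ?case using order_filt[OF _ Suc] by simp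
qed (use assms in simp)

lemma k_pos: "0 < int k" using fin one_closed by (auto simp: card_gt_0_iff)

text \<open>Writing q - p as |G|^n r, the augmentation of r vanishes, so r lies in A_1 and
  \<open>order_power_filt\<close> applies. Without augmentation 0 this fails: |G|^n itself is not in
  A_{n+1}.\<close>

lemma filt_cong:
  assumes p: "p \<in> filt G H (Suc n)" and q: "Poly_Mapping.keys q \<subseteq> carrier G" "eps q = 0"
    and cong: "\<And>g. g \<in> carrier G \<Longrightarrow> Poly_Mapping.lookup p g mod (int k ^ n) = Poly_Mapping.lookup q g mod (int k ^ n)"
  shows "q \<in> filt G H (Suc n)"
proof -
  let ?b = "int k ^ n"
  define r where "r = (\<Sum>g\<in>carrier G. frag_cmul ((Poly_Mapping.lookup q g - Poly_Mapping.lookup p g) div ?b) (frag_of g))"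
  have kp: "Poly_Mapping.keys p \<subseteq> carrier G" using p filt_subset_keys by blast
  have kr: "Poly_Mapping.keys r \<subseteq> carrier G"
    unfolding r_def by (rule order_trans[OF keys_sum]) auto
  have lr: "Poly_Mapping.lookup r g = (Poly_Mapping.lookup q g - Poly_Mapping.lookup p g) div ?b"
    if "g \<in> carrier G" for g
    using that fin by (simp add: r_def lookup_sum if_distrib cong: if_cong)
  have "q - p = frag_cmul ?b r"
  proof (rule poly_mapping_eqI)
    fix g show "Poly_Mapping.lookup (q - p) g = Poly_Mapping.lookup (frag_cmul ?b r) g"
    proof (cases "g \<in> carrier G")
      case True
      then have "?b dvd Poly_Mapping.lookup q g - Poly_Mapping.lookup p g"
        using cong[OF True] by (metis mod_eq_dvd_iff)
      then show ?thesis using lr[OF True] by (simp add: lookup_minus)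
    next
      case False
      then have "g \<notin> Poly_Mapping.keys q" "g \<notin> Poly_Mapping.keys p" "g \<notin> Poly_Mapping.keys r"
        using q kp kr by auto
      then show ?thesis by (simp add: lookup_minus in_keys_iff)
    qed
  qed
  moreover from this have "?b * eps r = 0"
    using q eps_filt[OF _ p] by (metis eps_simps(1,3) diff_self le_add1 plus_1_eq_Suc)
  then have "r \<in> filt G H 1" using k_pos kr by (intro filt_1I) auto
  ultimately have "q - p \<in> filt G H (Suc n)" using order_power_filt by simp
  from filt_add[OF this p] show ?thesis by simp
qed

end

section \<open>Correctness of the test on explicit tables\<close>

locale table_N_series = finite_N_series_group G H for G :: "nat monoid" (structure) and H +
  fixes N :: nat and T M :: "int mat" and n :: nat
  assumes table: "is_mult_table G T" and subgroup_table: "is_subgroup_table G H N M"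
    and n: "1 \<le> n" "n < N"
begin

lemma carrier_eq: "carrier G = {..<k}"
  using table by (auto simp: is_mult_table_def)

lemma carrier_iff: "x \<in> carrier G \<longleftrightarrow> x < k"
  by (subst carrier_eq) simp

lemma mat_get_T: "x < k \<Longrightarrow> y < k \<Longrightarrow> mat_get T (int x) (int y) = int (x \<otimes> y)"
  using table by (auto simp: is_mult_table_def mat_get_def)

lemma dim_row_T: "dim_row T = k"
  using table by (auto simp: is_mult_table_def)

lemma mat_get_M:
  assumes "1 \<le> a" "a \<le> N" "x < k" shows "mat_get M (int a - 1) (int x) = of_bool (x \<in> H a)"
proof -
  have "nat (int a - 1) = a - 1" by simp
  then show ?thesis using subgroup_table assms by (auto simp: is_subgroup_table_def mat_get_def)
qed

definition b :: int where "b = int k ^ n"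
definition V :: int where "V = b ^ k"
text \<open>Reduction of the group ring modulo b, followed by encoding; group elements are their own
  coordinate indices.\<close>

definition rd :: "(nat \<Rightarrow>\<^sub>0 int) \<Rightarrow> int" where "rd p = encode b (int k) (\<lambda>g. Poly_Mapping.lookup p (nat g))"

lemma b_pos: "0 < b" using k_pos by (simp add: b_def)
lemma V_pos: "0 < V" using b_pos by (simp add: V_def)

lemma rd_bounds: "rd p \<in> {0..<V}"
  using encode_bounds[OF b_pos] by (simp add: rd_def V_def)

lemma digit_rd: "0 \<le> g \<Longrightarrow> g < int k \<Longrightarrow> digit b (rd p) g = Poly_Mapping.lookup p (nat g) mod b"
  unfolding rd_def by (rule digit_encode[OF b_pos])

lemma rd_0: "rd 0 = 0" by (simp add: rd_def encode_def)

lemma rd_diff: "rd (p - q) = code_diff b (int k) (rd p) (rd q)"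
  unfolding rd_def[of "p - q"] code_diff_def
  by (rule encode_cong) (simp add: digit_rd lookup_minus mod_diff_eq)

lemma rd_frag_of: "rd (frag_of g) = encode b (int k) (\<lambda>i. of_bool (i = int g))"
  unfolding rd_def by (rule encode_cong) (auto simp: nat_eq_iff)

lemma rd_aug: "rd (aug G h) = encode b (int k) (\<lambda>g. of_bool (g = int h) - of_bool (g = int \<one>))"
  unfolding rd_def by (rule encode_cong) (auto simp: nat_eq_iff aug_def lookup_minus)

lemma lookup_aug_mult:
  assumes x: "x < k" and p: "Poly_Mapping.keys p \<subseteq> carrier G"
  shows "Poly_Mapping.lookup (aug_mult G x p) g =
     (\<Sum>y\<in>{..<k}. of_bool (x \<otimes> y = g) * Poly_Mapping.lookup p y) - Poly_Mapping.lookup p g"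
  using p
proof (induction p rule: frag_induction)
  case (one y)
  have "(\<Sum>z\<in>{..<k}. of_bool (x \<otimes> z = g) * Poly_Mapping.lookup (frag_of y) z) = of_bool (x \<otimes> y = g)"
  proof -
    have "(\<Sum>z<k. of_bool (x \<otimes> z = g) * Poly_Mapping.lookup (frag_of y) z) = (\<Sum>z<k. if z = y then of_bool (x \<otimes> y = g) else 0)"
      by (intro sum.cong) auto
    also have "\<dots> = of_bool (x \<otimes> y = g)"
      using one by (subst sum.delta) (auto simp: carrier_iff)
    finally show ?thesis .
  qed
  then show ?case using one by (auto simp: aug_mult_frag_of lookup_minus)
next
  case (diff p q)
  then show ?case by (simp add: aug_mult_simps lookup_minus sum_subtractf right_diff_distrib)
qed (simp add: aug_mult_simps)

lemma rd_aug_mult: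
  assumes x: "x < k" and p: "Poly_Mapping.keys p \<subseteq> carrier G"
  shows "rd (aug_mult G x p) = code_aug_mult T b (int k) (int x) (rd p)"
  unfolding rd_def[of "aug_mult G x p"] code_aug_mult_def
proof (rule encode_cong)
  fix g assume g: "0 \<le> g" "g < int k"
  let ?c = "\<lambda>y. of_bool (x \<otimes> y = nat g) :: int" and ?l = "Poly_Mapping.lookup p"
  have im: "{0..<int k} = int ` {..<k}"
    using image_int_atLeastLessThan[of 0 k] by (simp add: lessThan_atLeast0)
  have "(\<Sum>y\<in>{0..<int k}. of_bool (mat_get T (int x) y = g) * digit b (rd p) y) =
      (\<Sum>y<k. of_bool (mat_get T (int x) (int y) = g) * digit b (rd p) (int y))"
    unfolding im by (subst sum.reindex) (auto simp: inj_on_def)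
  also have "\<dots> = (\<Sum>y<k. ?c y * (?l y mod b))"
  proof (rule sum.cong)
    fix y assume "y \<in> {..<k}"
    moreover have "int (x \<otimes> y) = g \<longleftrightarrow> x \<otimes> y = nat g" using g by auto
    ultimately show "of_bool (mat_get T (int x) (int y) = g) * digit b (rd p) (int y) = ?c y * (?l y mod b)"
      using x by (simp add: mat_get_T digit_rd)
  qed simp
  finally have s: "(\<Sum>y\<in>{0..<int k}. of_bool (mat_get T (int x) y = g) * digit b (rd p) y) =
     (\<Sum>y<k. ?c y * (?l y mod b))" .
  have "(\<Sum>y<k. ?c y * (?l y mod b)) mod b = (\<Sum>y<k. ?c y * ?l y) mod b"
    by (subst (1 2) mod_sum_eq[symmetric]) (simp add: mod_mult_right_eq)
  then have "((\<Sum>y<k. ?c y * ?l y) - ?l (nat g)) mod b = ((\<Sum>y<k. ?c y * (?l y mod b)) - ?l (nat g) mod b) mod b"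
    by (intro mod_diff_cong) simp_all
  then show "Poly_Mapping.lookup (aug_mult G x p) (nat g) mod b =
      ((\<Sum>y\<in>{0..<int k}. of_bool (mat_get T (int x) y = g) * digit b (rd p) y) - digit b (rd p) g) mod b"
    unfolding s digit_rd[OF g] lookup_aug_mult[OF x p] .
qed

lemma idempotent_iff: "u < k \<Longrightarrow> u \<otimes> u = u \<longleftrightarrow> u = \<one>"
  using carrier_iff by (metis lessThan_iff l_one r_cancel_one')

text \<open>Soundness: an admissible family contains the images of all generators of A_i in its i-th
  member, by induction on the number of factors, so its last member cannot miss the image of an
  element of A_{n+1}.\<close>

lemma aug_excludedI:
  assumes U: "admissible T M b (int k) V (int n + 1) U" and h: "h \<in> carrier G"
    and not: "\<not> has_bit U V (int n + 1) (rd (aug G h))"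
  shows "aug G h \<notin> filt G H (Suc n)"
proof -
  let ?B = "\<lambda>i p. has_bit U V (int i) (rd p)"
  have diff: "?B i (p - q)" if "?B i p" "?B i q" "i \<le> Suc n" for i p q
  proof -
    have "int i \<in> {0..<int n + 1 + 1}" using that by auto
    then show ?thesis using U that rd_bounds[of p] rd_bounds[of q] unfolding admissible_def rd_diff by blast
  qed
  have zero: "?B i 0" if "i \<le> Suc n" for i
  proof -
    have "int i \<in> {0..<int n + 1 + 1}" using that by auto
    then show ?thesis using U unfolding admissible_def rd_0 by blast
  qed
  have aug: "?B i (aug_mult G x p)" if "1 \<le> a" "a \<le> i" "i \<le> Suc n" "x \<in> H a" "?B (i - a) p"
    "Poly_Mapping.keys p \<subseteq> carrier G" for i a x p
  proof -
    have x: "x < k" using that H_carrier carrier_iff by blast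
    have "int i \<in> {0..<int n + 1 + 1}" "int a \<in> {0..<int i + 1}" "int x \<in> {0..<int k}" "1 \<le> int a"
      "\<not> mat_get M (int a - 1) (int x) = 0" "has_bit U V (int i - int a) (rd p)"
      using that x n by (auto simp: mat_get_M of_nat_diff)
    then have "has_bit U V (int i) (code_aug_mult T b (int k) (int x) (rd p))"
      using U rd_bounds[of p] unfolding admissible_def by blast
    then show ?thesis using rd_aug_mult[OF x that(6)] by simp
  qed
  have all: "?B 0 p" if "Poly_Mapping.keys p \<subseteq> carrier G" for p
    using that
  proof (induction p rule: frag_induction)
    case (one g)
    then have "int g \<in> {0..<int k}" by (auto simp: carrier_iff nat_less_iff)
    then show ?case using U unfolding admissible_def rd_frag_of by simp
  qed (use diff[of 0] zero[of 0] in simp_all)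
  have prod: "?B i (aug_prod G ps)" if "graded H ps" "i \<le> weight ps" "i \<le> Suc n" for ps i
    using that
  proof (induction ps arbitrary: i)
    case Nil
    then show ?case using all[of "aug_prod G []"] keys_aug_prod[of "[]"] by simp
  next
    case (Cons xa ps)
    obtain x a where xa: "xa = (x, a)" by force
    have g: "1 \<le> a" "x \<in> H a" "graded H ps" using Cons.prems xa by auto
    have k: "Poly_Mapping.keys (aug_prod G ps) \<subseteq> carrier G" by (rule keys_aug_prod[OF g(3)])
    \<comment> \<open>The closure rule covers a \<le> i only. A heavier factor is regarded as an
      element of H_i, and the remaining product then only has to lie in the member of index 0, which
      contains everything.\<close>
    consider "i = 0" | "a \<le> i" | "1 \<le> i" "i < a" by linarith
    then show ?case
    proof cases
      case 1
      then show ?thesis using all[of "aug_prod G (xa # ps)"] keys_aug_prod[of "xa # ps"] Cons.prems by simp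
    next
      case 2
      then have "?B (i - a) (aug_prod G ps)" using Cons xa by (intro Cons.IH) auto
      then show ?thesis using aug[of a i x "aug_prod G ps"] 2 g k xa Cons.prems by simp
    next
      case 3
      then have "x \<in> H i" using g H_anti[of i a] by auto
      then show ?thesis using aug[of i i x "aug_prod G ps"] 3 k xa Cons.prems all[OF k] by simp
    qed
  qed
  have "?B (Suc n) p" if "p \<in> filt G H (Suc n)" for p
    using that by (induction rule: filt_induct) (use zero[of "Suc n"] diff[of "Suc n"] prod[of _ "Suc n"] in auto)
  then show ?thesis using not by (auto simp: add.commute)
qed

text \<open>Completeness: the witness is the filtration itself, reduced modulo b, and serves all h
  at once. That its last member misses h - 1 is where \<open>filt_cong\<close>, and so the choice of
  b, is needed.\<close>

lemma aug_excludedE: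
  obtains U where "U \<in> {0..<2 ^ nat ((int n + 1 + 1) * V)}" "admissible T M b (int k) V (int n + 1) U"
    "\<And>h. h \<in> carrier G \<Longrightarrow> aug G h \<notin> filt G H (Suc n) \<Longrightarrow> \<not> has_bit U V (int n + 1) (rd (aug G h))"
proof -
  define K where "K = nat ((int n + 1 + 1) * V)"
  have K: "int K = (int n + 1 + 1) * V" using V_pos by (simp add: K_def)
  \<comment> \<open>Division with remainder by V inverts the layout iV + v of
    \<open>has_bit\<close>.\<close>
  define U where "U = encode 2 (int K) (\<lambda>j. of_bool (j mod V \<in> rd ` filt G H (nat (j div V))))"
  have bit: "has_bit U V (int i) v \<longleftrightarrow> v \<in> rd ` filt G H i" if "i \<le> Suc n" "v \<in> {0..<V}" for i v
  proof -
    have "(int i + 1) * V \<le> (int n + 1 + 1) * V" using that V_pos by (intro mult_right_mono) auto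
    then have "int i * V + v < int K" using that by (simp add: K algebra_simps)
    moreover have "0 \<le> int i * V + v" using that V_pos by simp
    moreover have "(int i * V + v) mod V = v" "(int i * V + v) div V = int i" using that by auto
    ultimately show ?thesis unfolding has_bit_def U_def by (subst digit_encode) auto
  qed
  have Urange: "U \<in> {0..<2 ^ nat ((int n + 1 + 1) * V)}"
    using encode_bounds[of 2 K] by (simp add: U_def K_def)
  have nat_i: "\<exists>j. i = int j \<and> j \<le> Suc n" if "i \<in> {0..<int n + 1 + 1}" for i
    using that by (intro exI[of _ "nat i"]) auto
  have "admissible T M b (int k) V (int n + 1) U"
    unfolding admissible_def
  proof (intro conjI ballI impI)
    fix g assume g: "g \<in> {0..<int k}"
    then have "nat g \<in> carrier G" by (auto simp: carrier_iff nat_less_iff)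
    then have "frag_of (nat g) \<in> filt G H 0" by (intro filt_0) auto
    then have "has_bit U V (int 0) (rd (frag_of (nat g)))" using bit[of 0] rd_bounds by auto
    then show "has_bit U V 0 (encode b (int k) (\<lambda>i. of_bool (i = g)))" using g by (simp add: rd_frag_of)
  next
    fix i assume "i \<in> {0..<int n + 1 + 1}"
    then obtain j where j: "i = int j" "j \<le> Suc n" using nat_i by blast
    have "rd 0 \<in> rd ` filt G H j" by simp
    then show "has_bit U V i 0" using bit[of j "rd 0"] j rd_bounds[of 0] by (simp add: rd_0)
    fix v w assume vw: "v \<in> {0..<V}" "w \<in> {0..<V}" and "has_bit U V i v \<and> has_bit U V i w"
    then obtain p q where pq: "p \<in> filt G H j" "v = rd p" "q \<in> filt G H j" "w = rd q"
      using bit j by blast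
    then have "rd (p - q) \<in> rd ` filt G H j" by (intro imageI filt_diff)
    then show "has_bit U V i (code_diff b (int k) v w)"
      using bit[of j "rd (p - q)"] j rd_bounds[of "p - q"] pq by (simp add: rd_diff)
  next
    fix i a x v assume "i \<in> {0..<int n + 1 + 1}" and a: "a \<in> {0..<i + 1}" and x: "x \<in> {0..<int k}"
      and ax: "1 \<le> a \<and> \<not> mat_get M (a - 1) x = 0" and v: "v \<in> {0..<V}" "has_bit U V (i - a) v"
    then obtain j where j: "i = int j" "j \<le> Suc n" using nat_i by blast
    \<comment> \<open>From n < N follows a \<le> n + 1 \<le> N, so that \<open>M\<close> does have a
      row for H_a.\<close>
    have a': "1 \<le> nat a" "nat a \<le> N" "int (nat a) = a" "nat a \<le> j" using a ax j n by auto
    have x': "nat x < k" "int (nat x) = x" using x by auto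
    have xH: "nat x \<in> H (nat a)" using ax mat_get_M[of "nat a" "nat x"] a' x' by (auto split: if_splits)
    have "i - a = int (j - nat a)" using j a' by simp
    then have "v \<in> rd ` filt G H (j - nat a)" using v bit[of "j - nat a" v] j by simp
    then obtain p where p: "p \<in> filt G H (j - nat a)" "v = rd p" by blast
    have "aug_mult G (nat x) p \<in> filt G H (nat a + (j - nat a))" using xH p a' by (intro aug_mult_filt)
    then have "rd (aug_mult G (nat x) p) \<in> rd ` filt G H j" using a' by simp
    then have "has_bit U V i (rd (aug_mult G (nat x) p))" using bit[of j] j rd_bounds by auto
    then show "has_bit U V i (code_aug_mult T b (int k) x v)"
      using rd_aug_mult[OF x'(1) filt_subset_keys[OF p(1)]] p x' by simp
  qed
  moreover have "\<not> has_bit U V (int n + 1) (rd (aug G h))"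
    if h: "h \<in> carrier G" "aug G h \<notin> filt G H (Suc n)" for h
  proof
    assume "has_bit U V (int n + 1) (rd (aug G h))"
    then have "rd (aug G h) \<in> rd ` filt G H (Suc n)"
      using bit[of "Suc n"] rd_bounds by (simp add: add.commute)
    then obtain p where p: "p \<in> filt G H (Suc n)" "rd (aug G h) = rd p" by blast
    have "aug G h \<in> filt G H (Suc n)"
    proof (rule filt_cong[OF p(1)])
      show "Poly_Mapping.keys (aug G h) \<subseteq> carrier G" using h by (intro keys_aug)
      show "eps (aug G h) = 0" using eps_filt[OF _ aug_filt_1[OF h(1)]] by simp
      fix g assume "g \<in> carrier G"
      then have "0 \<le> int g" "int g < int k" by (auto simp: carrier_iff nat_less_iff)
      from encode_eqD[OF b_pos p(2)[unfolded rd_def] this]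
      show "Poly_Mapping.lookup p g mod int k ^ n = Poly_Mapping.lookup (aug G h) g mod int k ^ n"
        by (simp add: b_def)
    qed
    with h show False by simp
  qed
  ultimately show ?thesis using Urange by (intro that)
qed

lemma excluded_iff:
  assumes h: "h \<in> carrier G"
  shows "excluded T M b (int k) V (int n + 1) (int h) \<longleftrightarrow> aug G h \<notin> filt G H (Suc n)"
proof
  assume "excluded T M b (int k) V (int n + 1) (int h)"
  then obtain U u where U: "admissible T M b (int k) V (int n + 1) U" and u: "u \<in> {0..<int k}" "mat_get T u u = u"
    and no: "\<not> has_bit U V (int n + 1) (encode b (int k) (\<lambda>g. of_bool (g = int h) - of_bool (g = u)))"
    unfolding excluded_def by blast
  have u': "nat u < k" "int (nat u) = u" using u by auto
  then have "nat u \<otimes> nat u = nat u" using u mat_get_T[of "nat u" "nat u"] by auto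
  then have "u = int \<one>" using idempotent_iff u' by metis
  then show "aug G h \<notin> filt G H (Suc n)" using aug_excludedI[OF U h] no by (simp add: rd_aug)
next
  assume "aug G h \<notin> filt G H (Suc n)"
  obtain U where U: "U \<in> {0..<2 ^ nat ((int n + 1 + 1) * V)}" "admissible T M b (int k) V (int n + 1) U"
    and no: "\<not> has_bit U V (int n + 1) (rd (aug G h))"
    using aug_excludedE h \<open>aug G h \<notin> _\<close> by metis
  have "\<one> < k" using one_closed carrier_iff by blast
  then have "int \<one> \<in> {0..<int k}" "mat_get T (int \<one>) (int \<one>) = int \<one>" by (simp_all add: mat_get_T)
  then show "excluded T M b (int k) V (int n + 1) (int h)"
    unfolding excluded_def using U no by (intro bexI[of _ U] bexI[of _ "int \<one>"] conjI) (simp_all add: rd_aug)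
qed

lemma phi_injective_test:
  "phi_injective_test T M (int n) \<longleftrightarrow> (\<forall>h\<in>H n. aug G h \<in> filt G H (Suc n) \<longrightarrow> h \<in> H (Suc n))"
proof -
  have ball: "(\<forall>h\<in>{0..<int k}. P h) \<longleftrightarrow> (\<forall>h\<in>carrier G. P (int h))" for P
  by (metis carrier_iff atLeastLessThan_iff lessThan_iff of_nat_0_le_iff of_nat_less_iff zero_le_imp_eq_int)
  have M: "mat_get M (int n - 1) (int h) = of_bool (h \<in> H n)" "mat_get M (int n) (int h) = of_bool (h \<in> H (Suc n))"
    if "h \<in> carrier G" for h
    using that n mat_get_M[of n h] mat_get_M[of "Suc n" h] carrier_iff by auto
  have "phi_injective_test T M (int n) \<longleftrightarrow> (\<forall>h\<in>carrier G. h \<in> H n \<and> h \<notin> H (Suc n) \<longrightarrow> aug G h \<notin> filt G H (Suc n))"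
    unfolding phi_injective_test_def dim_row_T ball
    using excluded_iff M by (simp add: b_def V_def)
  then show ?thesis using H_carrier[OF n(1)] by blast
qed

end

text \<open>Unfolded, the test consists of table entries, arithmetic and quantifiers over intervals
  with computable ends.\<close>

lemma decidable_phi_injective_test: "decidable (\<lambda>T M e. phi_injective_test T M (e 0))"
  unfolding phi_injective_test_def excluded_def admissible_def has_bit_def code_diff_def
    code_aug_mult_def encode_def digit_def
  by (intro computable_intros)

theorem theorem4p1:
  shows "(\<forall>(G :: 'a monoid) H N s.
            finite_N_series G H N \<and> (\<forall>n\<in>{1..<N}. normalized_section G H n (s n)) \<longrightarrow>
            (realizes G H \<longleftrightarrow> (\<forall>n\<in>{1..<N}. trivial_group (coker_R_bar G H n (s n)))))
       \<and> (\<exists>p. \<forall>(G :: nat monoid) H N T M.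
            finite_N_series G H N \<and> is_mult_table G T \<and> is_subgroup_table G H N M \<longrightarrow>
            (\<forall>n\<in>{1..<N}. \<forall>s. normalized_section G H n s \<longrightarrow>
               answers p (input_state T M n) (trivial_group (coker_R_bar G H n s))))"
proof (intro conjI allI impI)
  fix G :: "'a monoid" and H N s
  assume "finite_N_series G H N \<and> (\<forall>n\<in>{1..<N}. normalized_section G H n (s n))"
  then show "realizes G H \<longleftrightarrow> (\<forall>n\<in>{1..<N}. trivial_group (coker_R_bar G H n (s n)))"
    by (intro realizes_iff_trivial_coker) auto
next
  \<comment> \<open>The program is fixed before any group, series or section, hence uniform in all
    of them.\<close>
  obtain p where p: "\<And>T M n. answers p (input_state T M n) (phi_injective_test T M (int n))"
    using decidable_program[OF decidable_phi_injective_test] by blast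
  have "answers p (input_state T M n) (trivial_group (coker_R_bar G H n s))"
    if series: "finite_N_series G H N" and tables: "is_mult_table G T" "is_subgroup_table G H N M"
      and n: "n \<in> {1..<N}" and s: "normalized_section G H n s" for G :: "nat monoid" and H N T M n s
  proof -
    interpret table_N_series G H N T M n
      using series tables n
      by (auto simp: finite_N_series_def table_N_series_def table_N_series_axioms_def
          finite_N_series_group_def finite_N_series_group_axioms_def N_series_group_def N_series_group_axioms_def)
    interpret N_series_section G H n s
      using n s by unfold_locales auto
    show ?thesis using p[of T M n] by (simp only: phi_injective_test trivial_coker_iff)
  qed
  then show "\<exists>p. \<forall>(G :: nat monoid) H N T M.
      finite_N_series G H N \<and> is_mult_table G T \<and> is_subgroup_table G H N M \<longrightarrow>
      (\<forall>n\<in>{1..<N}. \<forall>s. normalized_section G H n s \<longrightarrow>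
         answers p (input_state T M n) (trivial_group (coker_R_bar G H n s)))"
    by blast
qed

end
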